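(* Let $\beta>0$, $\mu\in\mathcal{P}_2^r(X)$, and let $(\mathbf{X}_t)_{t\ge0}$ be the Ornstein–Uhlenbeck process $d\mathbf{X}_t=-\mathbf{X}_t\,dt+\sqrt{2\beta^{-1}}\,d\mathbf{B}_t$ with $\mathbf{X}_0\sim\mu$; let $\mu_t$ be the law of $\mathbf{X}_t$, so that $\mathbf{X}_t\overset{d}{=}e^{-t}\mathbf{X}_0+\sqrt{\beta^{-1}(1-e^{-2t})}\,\mathbf{Z}$ with $\mathbf{Z}\sim\mathcal{N}(0,I_d)$ independent. Fix $t>0$, set $\mathsf r(t):=\frac{e^{-t}}{\sqrt{\beta^{-1}(1-e^{-2t})}}$, and define the backward map $\mathbf{b}^{\mu,\eta}:=\mathrm{id}+\eta(\mathrm{id}+\beta^{-1}\nabla\log p_{\mu_t})$. Then for every $M\ge1$ and every $\delta\in(0,1]$, $$\limsup_{\eta\to0}\ \limsup_{\nu\in\mathcal{M}(\mu_t,M):\,\nu\xrightarrow{W_2}\mu_t}\ \frac{1}{\eta}\,\frac{W_2^2(\mathbf{b}^{\mu,\eta}_\#\mu_t,\mathbf{b}^{\mu,\eta}_\#\nu)-W_2^2(\mu_t,\nu)}{W_2^2(\mu_t,\nu)}\le 2-\frac{2}{1-e^{-2t}}\Big[\delta-M\cdot h_\mu(\delta,\mathsf r(t))\Big].$$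
   Context: $\mathcal{P}_2^r(X)$ denotes probability measures on $X\subseteq\mathbb{R}^d$ with finite second moment, absolutely continuous w.r.t. Lebesgue measure; $p_\nu$ is the density of $\nu$; $W_2$ the Wasserstein-2 distance; $\mathbf{T}_\#\mu$ pushforward; $\mathrm{id}$ the identity. For $\mu,\nu\in\mathcal{P}_2^r(X)$, $\mathbf{t}^{\nu}_{\mu}$ denotes the optimal transport (Brenier) map pushing $\mu$ to $\nu$. For $M\ge1$, $\mathcal{M}(\mu,M):=\{\nu\in\mathcal{P}_2^r(X): \sup_{x\in\mathrm{Dom}(\mu)}\|\mathbf{t}^\nu_\mu(x)-x\|^2\le M\int\|\mathbf{t}^\nu_\mu(x)-x\|^2d\mu(x)\}$. For SNR $\mathsf r\ge0$, let $\mathbf{Y}_{\mathsf r}:=\mathsf r\mathbf{X}+\mathbf{Z}$ with $\mathbf{X}\sim\mu$, $\mathbf{Z}\sim\mathcal{N}(0,I_d)$ independent; $L_{\mathsf r}(y)=\|\mathrm{Cov}[\mathsf r\mathbf{X}\mid\mathbf{Y}_{\mathsf r}=y]\|_{op}$, $\mathbf{L}_{\mathsf r}=L_{\mathsf r}(\mathbf{Y}_{\mathsf r})$, $s_{\mathsf r}(u)=\mathbb{P}(\mathbf{L}_{\mathsf r}>u)$, and $h_\mu(\delta,\mathsf r):=\int_{1-\delta}^\infty s_{\mathsf r}(u)\,du$. *)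

theory Defs
  imports "HOL-Probability.Probability"
begin

definition P2r :: "'a::euclidean_space measure set" where
  "P2r = {m. prob_space m \<and> sets m = sets borel \<and> absolutely_continuous lborel m
              \<and> integrable m (\<lambda>x. (norm x)^2)}"

definition couplings :: "'a::euclidean_space measure \<Rightarrow> 'a measure \<Rightarrow> ('a \<times> 'a) measure set" where
  "couplings m n = {p. prob_space p \<and> sets p = sets (borel \<Otimes>\<^sub>M borel)
                      \<and> distr p borel fst = m \<and> distr p borel snd = n}"

definition W2sq :: "'a::euclidean_space measure \<Rightarrow> 'a measure \<Rightarrow> ennreal" where
  "W2sq m n = (INF p\<in>couplings m n. \<integral>\<^sup>+ z. ennreal ((norm (fst z - snd z))^2) \<partial>p)"

definition push :: "('a::euclidean_space \<Rightarrow> 'a) \<Rightarrow> 'a measure \<Rightarrow> 'a measure" where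
  "push T m = distr m borel T"

definition Mclass :: "'a::euclidean_space measure \<Rightarrow> real \<Rightarrow> 'a measure set" where
  "Mclass m K = {n \<in> P2r. \<exists>T. T \<in> m \<rightarrow>\<^sub>M borel \<and> distr m borel T = n
      \<and> (\<integral>\<^sup>+ x. ennreal ((norm (T x - x))^2) \<partial>m) = W2sq m n
      \<and> (AE x in m. ennreal ((norm (T x - x))^2)
                      \<le> ennreal K * (\<integral>\<^sup>+ x. ennreal ((norm (T x - x))^2) \<partial>m))}"

definition gauss_dens :: "real \<Rightarrow> 'a::euclidean_space \<Rightarrow> real" where
  "gauss_dens s v = (2 * pi * s^2) powr (- real DIM('a) / 2) * exp (- ((norm v)^2) / (2 * s^2))"

definition std_gauss :: "'a::euclidean_space measure" where
  "std_gauss = density lborel (\<lambda>v. ennreal (gauss_dens 1 v))"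

definition ou_sigma :: "real \<Rightarrow> real \<Rightarrow> real" where
  "ou_sigma \<beta> t = sqrt ((1 / \<beta>) * (1 - exp (- 2 * t)))"

definition ou_law :: "real \<Rightarrow> 'a::euclidean_space measure \<Rightarrow> real \<Rightarrow> 'a measure" where
  "ou_law \<beta> m t = distr (m \<Otimes>\<^sub>M std_gauss) borel
                      (\<lambda>(x, z). exp (- t) *\<^sub>R x + ou_sigma \<beta> t *\<^sub>R z)"

text \<open>The (smooth version of the) Lebesgue density p_{mu_t} of mu_t.\<close>
definition ou_density :: "real \<Rightarrow> 'a::euclidean_space measure \<Rightarrow> real \<Rightarrow> 'a \<Rightarrow> real" where
  "ou_density \<beta> m t y = (\<integral> x. gauss_dens (ou_sigma \<beta> t) (y - exp (- t) *\<^sub>R x) \<partial>m)"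

definition grad :: "('a::euclidean_space \<Rightarrow> real) \<Rightarrow> 'a \<Rightarrow> 'a" where
  "grad f y = (SOME g. (f has_derivative (\<lambda>h. g \<bullet> h)) (at y))"

definition backward_map :: "real \<Rightarrow> 'a::euclidean_space measure \<Rightarrow> real \<Rightarrow> real \<Rightarrow> 'a \<Rightarrow> 'a" where
  "backward_map \<beta> m t \<eta> x =
     x + \<eta> *\<^sub>R (x + (1 / \<beta>) *\<^sub>R grad (\<lambda>y. ln (ou_density \<beta> m t y)) x)"

definition snr :: "real \<Rightarrow> real \<Rightarrow> real" where
  "snr \<beta> t = exp (- t) / ou_sigma \<beta> t"

text \<open>Posterior of X given Y_r = y (Bayes): density proportional to
exp(-|y - r x|^2/2) w.r.t. mu.\<close>
definition post_w :: "real \<Rightarrow> 'a::euclidean_space \<Rightarrow> 'a \<Rightarrow> real" where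
  "post_w r y x = exp (- ((norm (y - r *\<^sub>R x))^2) / 2)"

definition post_mean :: "real \<Rightarrow> 'a::euclidean_space measure \<Rightarrow> 'a \<Rightarrow> 'a" where
  "post_mean r m y = (\<integral> x. post_w r y x *\<^sub>R (r *\<^sub>R x) \<partial>m) /\<^sub>R (\<integral> x. post_w r y x \<partial>m)"

definition post_cov :: "real \<Rightarrow> 'a::euclidean_space measure \<Rightarrow> 'a \<Rightarrow> 'a \<Rightarrow> 'a" where
  "post_cov r m y v =
     (\<integral> x. (post_w r y x * ((r *\<^sub>R x - post_mean r m y) \<bullet> v)) *\<^sub>R (r *\<^sub>R x - post_mean r m y) \<partial>m)
       /\<^sub>R (\<integral> x. post_w r y x \<partial>m)"

definition Lfun :: "real \<Rightarrow> 'a::euclidean_space measure \<Rightarrow> 'a \<Rightarrow> real" where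
  "Lfun r m y = onorm (post_cov r m y)"

definition Ylaw :: "real \<Rightarrow> 'a::euclidean_space measure \<Rightarrow> 'a measure" where
  "Ylaw r m = distr (m \<Otimes>\<^sub>M std_gauss) borel (\<lambda>(x, z). r *\<^sub>R x + z)"

definition sfun :: "real \<Rightarrow> 'a::euclidean_space measure \<Rightarrow> real \<Rightarrow> real" where
  "sfun r m u = measure (Ylaw r m) {y. Lfun r m y > u}"

definition hfun :: "'a::euclidean_space measure \<Rightarrow> real \<Rightarrow> real \<Rightarrow> ennreal" where
  "hfun m \<delta> r = (\<integral>\<^sup>+ u \<in> {1 - \<delta>..}. ennreal (sfun r m u) \<partial>lborel)"

end

(* With r = snr \<beta> t, \<sigma> = ou_sigma \<beta> t and rate = 1 / (1 - exp (- 2 t)), Tweedie's formula turns the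
   backward map into  b(y) = (1 + \<eta> (1 - rate)) y + \<eta> rate \<sigma> m(y / \<sigma>),  where m is the posterior mean of
   r X given Y_r.  The derivative of m is the posterior covariance, so b expands a displacement v at y by
   at most 1 + \<eta> (1 - rate + rate L), L being the supremum of Lfun on a small ball around y / \<sigma>.
   Transporting with (b, b o T), the linear term in \<eta> is at most
   2 (1 - rate \<delta>) |v|^2 + 2 rate |v|^2 (L - (1 - \<delta>))_+, and in the last summand the Mclass bound replaces
   |v|^2 by K W2^2; the expectation of (Lfun - (1 - \<delta>))_+ is hfun by the layer-cake formula.

   The limit as the ball shrinks is justified by an explicit envelope of Lfun near y, which decreases
   to Lfun(y) and is square integrable because the posterior of the noise has exponential moments
   integrating to Gaussian ones.  Measurability of Lfun is a by-product: the envelope makes it upper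
   semicontinuous. *)
theory Submission
  imports Defs
begin

section \<open>Analytic preliminaries\<close>

text \<open>The posterior covariance need not be bounded in \<open>y\<close>, so the posterior mean
  has no global Lipschitz constant and the backward map must be controlled locally.
  \<open>Mclass\<close> makes this possible: the optimal map moves almost every point by at most
  sqrt (K * W2sq), so closeness in W2 puts all displacements into one small ball. The threshold
  enters through 1 - rate + rate * L = (1 - rate * \<delta>) + rate * (L - (1 - \<delta>)): the
  first part is constant in \<open>y\<close> and meets the exact transport cost, and only the
  positive part of the second has to be averaged apart from the displacement. A plain supremum of
  \<open>Lfun\<close> over a ball is neither visibly measurable nor visibly integrable; a formula
  built from posterior expectations is both. Square integrability is wanted because squaring the
  expansion factor leaves a term of order \<eta>^2 that contains L^2. That term is estimated with
  radius 1 throughout, so the radius can tend to zero at fixed \<eta>, and \<eta>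
  afterwards.\<close>

lemma norm_add_sq: "(norm (u + v))\<^sup>2 = (norm u)\<^sup>2 + 2 * (u \<bullet> v) + (norm v)\<^sup>2"
  for u v :: "'a::real_inner"
  by (simp add: power2_norm_eq_inner inner_add_left inner_add_right inner_commute)

text \<open>The bound \<open>C\<close> is uniform in both arguments, so the mean value inequality
  bounds every difference quotient by \<open>C\<close> and the remainder quotient \<open>R\<close>
  by 2 * C, a constant that is integrable because the measure is finite. Dominated convergence
  concerns sequences, hence the limit in \<open>h\<close> is tested along sequences.\<close>

lemma has_derivative_integral_dominated:
  fixes f :: "'a::real_normed_vector \<Rightarrow> 'b \<Rightarrow> 'c::{banach, second_countable_topology}"
  assumes "finite_measure M"
    and der: "\<And>x y. ((\<lambda>y. f y x) has_derivative f' y x) (at y)"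
    and "0 \<le> C"
    and bound: "\<And>x y h. norm (f' y x h) \<le> C * norm h"
    and f [measurable]: "\<And>y. integrable M (f y)"
    and f' [measurable]: "\<And>y h. (\<lambda>x. f' y x h) \<in> borel_measurable M"
  shows "((\<lambda>y. \<integral>x. f y x \<partial>M) has_derivative (\<lambda>h. \<integral>x. f' y x h \<partial>M)) (at y)"
proof -
  interpret finite_measure M by fact
  have int_f': "integrable M (\<lambda>x. f' z x h)" for z h
    by (rule integrable_const_bound[of _ "C * norm h"]) (use bound in auto)
  have bl: "bounded_linear (f' z x)" for z x
    using der by (rule has_derivative_bounded_linear)
  have lin: "bounded_linear (\<lambda>h. \<integral>x. f' y x h \<partial>M)"
  proof (rule bounded_linear_intro[of _ "C * measure M (space M)"])
    show "(\<integral>x. f' y x (h + k) \<partial>M) = (\<integral>x. f' y x h \<partial>M) + (\<integral>x. f' y x k \<partial>M)" for h k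
      by (simp add: linear_simps[OF bl] int_f')
    show "(\<integral>x. f' y x (c *\<^sub>R h) \<partial>M) = c *\<^sub>R (\<integral>x. f' y x h \<partial>M)" for c h
      by (simp add: linear_simps[OF bl])
    show "norm (\<integral>x. f' y x h \<partial>M) \<le> norm h * (C * measure M (space M))" for h
    proof -
      have "norm (\<integral>x. f' y x h \<partial>M) \<le> (\<integral>x. norm (f' y x h) \<partial>M)"
        by (rule integral_norm_bound)
      also have "\<dots> \<le> (\<integral>x. C * norm h \<partial>M)"
        by (rule integral_mono) (use int_f' bound in auto)
      also have "\<dots> = norm h * (C * measure M (space M))" by simp
      finally show ?thesis .
    qed
  qed
  have lip: "norm (f (y + h) x - f y x) \<le> C * norm h" for h x
  proof -
    have "norm (f (y + h) x - f y x) \<le> C * norm (y + h - y)"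
      by (rule differentiable_bound[of UNIV "\<lambda>y. f y x" "\<lambda>y. f' y x"])
         (use der bound \<open>0 \<le> C\<close> in \<open>auto intro!: onorm_bound\<close>)
    then show ?thesis by simp
  qed
  define R where "R h x = norm (f (y + h) x - f y x - f' y x h) / norm h" for h x
  have R_bound: "norm (R h x) \<le> 2 * C" if "h \<noteq> 0" for h x
  proof -
    have "norm (f (y + h) x - f y x - f' y x h) \<le> C * norm h + C * norm h"
      by (rule order_trans[OF norm_triangle_ineq4]) (intro add_mono lip bound)
    then show ?thesis using that by (simp add: R_def divide_simps)
  qed
  have [measurable]: "R h \<in> borel_measurable M" for h unfolding R_def by measurable
  have R_lim: "((\<lambda>h. \<integral>x. R h x \<partial>M) \<longlongrightarrow> 0) (at 0)"
  proof (subst tendsto_at_iff_sequentially, intro allI impI)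
    fix X :: "nat \<Rightarrow> 'a" assume X: "\<forall>i. X i \<in> UNIV - {0}" "X \<longlonglongrightarrow> 0"
    have "(\<lambda>i. \<integral>x. R (X i) x \<partial>M) \<longlonglongrightarrow> (\<integral>x. 0 \<partial>M)"
    proof (rule integral_dominated_convergence[where w = "\<lambda>_. 2 * C"])
      show "AE x in M. (\<lambda>i. R (X i) x) \<longlonglongrightarrow> 0"
      proof (rule AE_I2)
        fix x
        have "(\<lambda>h. R h x) \<midarrow>0\<rightarrow> 0"
          using der[where x = x and y = y] unfolding has_derivative_at R_def by simp
        then show "(\<lambda>i. R (X i) x) \<longlonglongrightarrow> 0"
          using X by (auto simp: tendsto_at_iff_sequentially o_def)
      qed
      show "AE x in M. norm (R (X i) x) \<le> 2 * C" for i
        using X(1) by (intro AE_I2 R_bound) auto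
    qed auto
    then show "((\<lambda>h. \<integral>x. R h x \<partial>M) \<circ> X) \<longlonglongrightarrow> 0" by (simp add: o_def)
  qed
  have R_ge: "norm (norm ((\<integral>x. f (y + h) x \<partial>M) - (\<integral>x. f y x \<partial>M) - (\<integral>x. f' y x h \<partial>M)) / norm h)
      \<le> (\<integral>x. R h x \<partial>M)" for h
  proof -
    have "(\<integral>x. f (y + h) x \<partial>M) - (\<integral>x. f y x \<partial>M) - (\<integral>x. f' y x h \<partial>M)
        = (\<integral>x. f (y + h) x - f y x - f' y x h \<partial>M)"
      by (simp add: f int_f')
    then show ?thesis
      by (simp add: R_def divide_right_mono integral_norm_bound)
  qed
  have "(\<lambda>h. norm ((\<integral>x. f (y + h) x \<partial>M) - (\<integral>x. f y x \<partial>M) - (\<integral>x. f' y x h \<partial>M)) / norm h)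
      \<midarrow>0\<rightarrow> 0"
    by (rule Lim_null_comparison[OF always_eventually R_lim]) (rule allI, rule R_ge)
  with lin show ?thesis by (simp add: has_derivative_at)
qed

text \<open>For symmetric operators the quadratic form controls the norm, via
  \<open>u \<bullet> A v \<le> (u \<bullet> A u + v \<bullet> A v) / 2\<close>, applied with \<open>u\<close> the multiple of \<open>A v\<close> of length \<open>norm v\<close>.\<close>
lemma onorm_le_quadratic_form:
  fixes A :: "'a::real_inner \<Rightarrow> 'a"
  assumes lin: "linear A" and "0 \<le> B"
    and polar: "\<And>u v. u \<bullet> A v \<le> (u \<bullet> A u + v \<bullet> A v) / 2"
    and quad: "\<And>u. u \<bullet> A u \<le> B * (norm u)\<^sup>2"
  shows "onorm A \<le> B"
proof (rule onorm_bound[OF \<open>0 \<le> B\<close>])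
  fix v
  show "norm (A v) \<le> B * norm v"
  proof (cases "A v = 0 \<or> v = 0")
    case True
    then show ?thesis using linear_0[OF lin] \<open>0 \<le> B\<close> by auto
  next
    case False
    define u where "u = (norm v / norm (A v)) *\<^sub>R A v"
    have "norm v * norm (A v) = u \<bullet> A v"
      using False by (simp add: u_def power2_norm_eq_inner[symmetric] power2_eq_square)
    also have "\<dots> \<le> (u \<bullet> A u + v \<bullet> A v) / 2" by (rule polar)
    also have "\<dots> \<le> (B * (norm u)\<^sup>2 + B * (norm v)\<^sup>2) / 2"
      by (intro divide_right_mono add_mono quad) simp
    also have "norm u = norm v" using False by (simp add: u_def)
    finally show ?thesis using False by (simp add: power2_eq_square)
  qed
qed

text \<open>Tonelli on the region c \<le> u < f x. Since \<open>ennreal\<close> sends negative reals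
  to 0, the right side integrates the positive part of f x - c.\<close>

lemma nn_integral_layer_cake_ge:
  fixes f :: "'a \<Rightarrow> real"
  assumes "sigma_finite_measure M" and [measurable]: "f \<in> borel_measurable M"
  shows "(\<integral>\<^sup>+u\<in>{c..}. emeasure M {x \<in> space M. u < f x} \<partial>lborel) = (\<integral>\<^sup>+x. ennreal (f x - c) \<partial>M)"
proof -
  interpret sigma_finite_measure M by fact
  interpret pair_sigma_finite lborel M ..
  have "(\<integral>\<^sup>+u\<in>{c..}. emeasure M {x \<in> space M. u < f x} \<partial>lborel)
      = (\<integral>\<^sup>+u. (\<integral>\<^sup>+x. indicator {c..<f x} u \<partial>M) \<partial>lborel)"
  proof (rule nn_integral_cong)
    fix u :: real
    have "emeasure M {x \<in> space M. u < f x} * indicator {c..} u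
        = (\<integral>\<^sup>+x. indicator {x \<in> space M. u < f x} x * indicator {c..} u \<partial>M)"
      by (subst nn_integral_multc) auto
    also have "\<dots> = (\<integral>\<^sup>+x. indicator {c..<f x} u \<partial>M)"
      by (rule nn_integral_cong) (auto simp: indicator_def)
    finally show "emeasure M {x \<in> space M. u < f x} * indicator {c..} u = \<dots>" .
  qed
  also have "\<dots> = (\<integral>\<^sup>+x. (\<integral>\<^sup>+u. indicator {c..<f x} u \<partial>lborel) \<partial>M)"
  proof (rule Fubini'[symmetric])
    have "(\<lambda>(u, x). if c \<le> u \<and> u < f x then 1 else 0 :: ennreal) \<in> borel_measurable (lborel \<Otimes>\<^sub>M M)"
      by measurable
    then show "(\<lambda>(u, x). indicator {c..<f x} u :: ennreal) \<in> borel_measurable (lborel \<Otimes>\<^sub>M M)"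
      by (simp add: indicator_def case_prod_beta cong: measurable_cong)
  qed
  also have "\<dots> = (\<integral>\<^sup>+x. ennreal (f x - c) \<partial>M)"
  proof (rule nn_integral_cong)
    fix x
    show "(\<integral>\<^sup>+u. indicator {c..<f x} u \<partial>lborel) = ennreal (f x - c)"
      by (cases "c \<le> f x") (auto simp: ennreal_neg)
  qed
  finally show ?thesis .
qed

text \<open>The isotropic density is a product over \<open>Basis\<close> of one-dimensional normal
  densities, each of mass 1; the work lies in splitting the power -d/2 of 2 pi s^2 into d
  factors.\<close>

lemma nn_integral_gauss:
  assumes "0 < s"
  shows "(\<integral>\<^sup>+v. ennreal (gauss_dens s v) \<partial>(lborel :: 'a::euclidean_space measure)) = 1"
proof -
  have sq: "(norm v)\<^sup>2 = (\<Sum>b\<in>Basis. (v \<bullet> b)\<^sup>2)" for v :: 'a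
    unfolding power2_norm_eq_inner by (subst euclidean_inner) (simp add: power2_eq_square)
  have "gauss_dens s v = (\<Prod>b\<in>Basis. normal_density 0 s (v \<bullet> b))" for v :: 'a
  proof -
    define X where "X = 2 * pi * s\<^sup>2"
    have "X > 0" using assms by (simp add: X_def)
    have "X powr (- (1 / 2)) = 1 / sqrt X"
      unfolding powr_minus using powr_half_sqrt[of X] \<open>X > 0\<close> by (simp only: less_imp_le inverse_eq_divide)
    then have "(1 / sqrt X) ^ DIM('a) = (X powr (- (1 / 2))) ^ DIM('a)"
      by (simp only:)
    also have "\<dots> = X powr (- real DIM('a) / 2)"
      using \<open>X > 0\<close> by (simp add: powr_realpow[symmetric] powr_powr del: powr_realpow)
    finally have "X powr (- real DIM('a) / 2) = (1 / sqrt X) ^ DIM('a)" ..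
    moreover have "exp (- (norm v)\<^sup>2 / (2 * s\<^sup>2)) = (\<Prod>b\<in>Basis. exp (- (v \<bullet> b)\<^sup>2 / (2 * s\<^sup>2)))"
      by (simp only: sq exp_sum[symmetric] sum_divide_distrib[symmetric] sum_negf finite_Basis)
    moreover have "(\<Prod>b\<in>Basis. normal_density 0 s (v \<bullet> b))
        = (1 / sqrt X) ^ DIM('a) * (\<Prod>b\<in>Basis. exp (- (v \<bullet> b)\<^sup>2 / (2 * s\<^sup>2)))"
      unfolding normal_density_def prod.distrib X_def by (simp only: prod_constant diff_0_right)
    moreover have "gauss_dens s v = X powr (- real DIM('a) / 2) * exp (- (norm v)\<^sup>2 / (2 * s\<^sup>2))"
      by (simp only: gauss_dens_def X_def)
    ultimately show ?thesis by metis
  qed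
  then have "(\<integral>\<^sup>+v. ennreal (gauss_dens s v) \<partial>(lborel :: 'a measure))
      = (\<integral>\<^sup>+v. (\<Prod>b\<in>Basis. ennreal (normal_density 0 s (v \<bullet> b))) \<partial>(lborel :: 'a measure))"
    by (simp add: prod_ennreal)
  also have "\<dots> = (\<Prod>b\<in>(Basis::'a set). \<integral>\<^sup>+x. ennreal (normal_density 0 s x) \<partial>lborel)"
    by (rule nn_integral_lborel_prod) auto
  also have "\<dots> = 1"
    using assms by (simp add: nn_integral_eq_integral)
  finally show ?thesis .
qed

lemma prob_space_std_gauss: "prob_space (std_gauss :: 'a::euclidean_space measure)"
proof (rule prob_spaceI)
  have [measurable]: "gauss_dens 1 \<in> borel_measurable (borel :: 'a measure)"
    unfolding gauss_dens_def by measurable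
  show "emeasure (std_gauss :: 'a measure) (space std_gauss) = 1"
    using nn_integral_gauss[of 1] by (simp add: std_gauss_def emeasure_density)
qed

section \<open>Posterior calculus for the Gaussian channel\<close>

locale gaussian_channel = prob_space M for M :: "'a::euclidean_space measure" +
  fixes r :: real
  assumes sets_M [measurable_cong]: "sets M = sets borel"
begin

text \<open>The value that the Gaussian Z must have had if X = x and Y_r = y.\<close>

definition noise :: "'a \<Rightarrow> 'a \<Rightarrow> 'a" where
  "noise y x = y - r *\<^sub>R x"

text \<open>Up to the factor (2 pi)^(-d/2) this is the Lebesgue density of
  \<open>Ylaw r M\<close>.\<close>

definition evidence :: "'a \<Rightarrow> real" where
  "evidence y = (\<integral>x. post_w r y x \<partial>M)"

definition posterior :: "'a \<Rightarrow> 'a measure" where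
  "posterior y = density M (\<lambda>x. ennreal (post_w r y x / evidence y))"

abbreviation pmean :: "'a \<Rightarrow> 'a" where
  "pmean y \<equiv> post_mean r M y"

lemma noise_measurable [measurable (raw)]:
  assumes [measurable]: "f \<in> borel_measurable N" "g \<in> borel_measurable N"
  shows "(\<lambda>z. noise (f z) (g z)) \<in> borel_measurable N"
  unfolding noise_def by measurable

lemma post_w_measurable [measurable (raw)]:
  assumes [measurable]: "f \<in> borel_measurable N" "g \<in> borel_measurable N"
  shows "(\<lambda>z. post_w r (f z) (g z)) \<in> borel_measurable N"
  unfolding post_w_def by measurable

lemma post_w_noise: "post_w r y x = exp (- (norm (noise y x))\<^sup>2 / 2)"
  by (simp add: post_w_def noise_def)

lemma post_w_pos: "0 < post_w r y x"
  by (simp add: post_w_def)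

lemma post_w_nonneg [simp]: "0 \<le> post_w r y x"
  by (simp add: post_w_def)

lemma norm_noise_le_exp: "norm (noise y x) \<le> exp (norm (noise y x))"
  by (rule order_trans[OF _ exp_ge_add_one_self]) simp

lemma post_w_le_1: "post_w r y x \<le> 1"
  by (simp add: post_w_def)

text \<open>The Gaussian weight beats powers of the noise uniformly in \<open>y\<close> and
  \<open>x\<close>. This bound and the next supply the constants 1 and 3 = 1 + 2 with which the
  evidence and the weighted noise are differentiated under the integral.\<close>

lemma post_w_norm_noise_le: "post_w r y x * norm (noise y x) \<le> 1"
proof -
  let ?n = "norm (noise y x)"
  have "?n \<le> 1 + ?n\<^sup>2 / 2"
    using sum_squares_ge_zero[of "?n - 1" 1] by (simp add: power2_eq_square algebra_simps)
  also have "\<dots> \<le> exp (?n\<^sup>2 / 2)" by (rule exp_ge_add_one_self)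
  finally show ?thesis by (simp add: post_w_noise exp_minus field_simps)
qed

lemma post_w_norm_noise_sq_le: "post_w r y x * (norm (noise y x))\<^sup>2 \<le> 2"
proof -
  let ?n = "norm (noise y x)"
  have "?n\<^sup>2 \<le> 2 * exp (?n\<^sup>2 / 2)"
    using exp_ge_add_one_self[of "?n\<^sup>2 / 2"] by linarith
  then show ?thesis by (simp add: post_w_noise exp_minus field_simps)
qed

text \<open>Completing the square in c * n - n^2 / 2.\<close>

lemma post_w_exp_le: "post_w r y x * exp (c * norm (noise y x)) \<le> exp (c\<^sup>2 / 2)"
proof -
  have "0 \<le> (norm (noise y x) - c)\<^sup>2" by simp
  then show ?thesis
    by (simp add: post_w_noise exp_add[symmetric] power2_eq_square algebra_simps)
qed

lemma integrable_post_w: "integrable M (post_w r y)"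
  by (rule integrable_const_bound[of _ 1]) (auto simp: post_w_pos[THEN less_imp_le] post_w_le_1)

lemma evidence_pos: "0 < evidence y"
proof -
  have "evidence y \<noteq> 0"
  proof
    assume "evidence y = 0"
    then have "AE x in M. post_w r y x = 0"
      using integral_nonneg_eq_0_iff_AE[OF integrable_post_w, of y] by (simp add: evidence_def)
    then have "AE x in M. False"
      by (rule AE_mp) (use post_w_pos in \<open>auto intro!: AE_I2 simp: less_le\<close>)
    then show False by simp
  qed
  moreover have "0 \<le> evidence y"
    unfolding evidence_def by (rule Bochner_Integration.integral_nonneg) simp
  ultimately show ?thesis by simp
qed

lemma sets_posterior [measurable_cong, simp]: "sets (posterior y) = sets borel"
  by (simp add: posterior_def sets_M)

lemma space_posterior [simp]: "space (posterior y) = UNIV"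
  using sets_eq_imp_space_eq[OF sets_posterior[of y]] by simp

lemma integral_posterior:
  fixes g :: "'a \<Rightarrow> 'b::{banach, second_countable_topology}"
  assumes [measurable]: "g \<in> borel_measurable borel"
  shows "(\<integral>x. g x \<partial>posterior y) = (\<integral>x. post_w r y x *\<^sub>R g x \<partial>M) /\<^sub>R evidence y"
proof -
  have "(\<integral>x. g x \<partial>posterior y) = (\<integral>x. inverse (evidence y) *\<^sub>R (post_w r y x *\<^sub>R g x) \<partial>M)"
    unfolding posterior_def
    by (subst integral_density)
       (auto simp: evidence_pos post_w_pos divide_inverse mult.commute less_imp_le)
  then show ?thesis by (simp only: integral_scaleR_right)
qed

text \<open>The integrability test for nearly everything below: the weight absorbs exponential
  growth of any rate in the noise, so all posterior moments exist whatever the tails of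
  \<open>M\<close>.\<close>

lemma integrable_posterior:
  fixes g :: "'a \<Rightarrow> 'b::{banach, second_countable_topology}"
  assumes [measurable]: "g \<in> borel_measurable borel"
    and bound: "\<And>x. norm (g x) \<le> B * exp (c * norm (noise y x))"
  shows "integrable (posterior y) g"
proof -
  have "integrable M (\<lambda>x. (post_w r y x / evidence y) *\<^sub>R g x)"
  proof (rule integrable_const_bound)
    show "AE x in M. norm ((post_w r y x / evidence y) *\<^sub>R g x) \<le> B * exp (c\<^sup>2 / 2) / evidence y"
    proof (rule AE_I2)
      fix x
      have "0 \<le> B"
        using order_trans[OF norm_ge_zero bound[of x]] by (simp add: zero_le_mult_iff)
      have "post_w r y x * norm (g x) \<le> post_w r y x * (B * exp (c * norm (noise y x)))"
        by (intro mult_left_mono bound post_w_pos[THEN less_imp_le])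
      also have "\<dots> \<le> B * exp (c\<^sup>2 / 2)"
        using mult_left_mono[OF post_w_exp_le \<open>0 \<le> B\<close>] by (simp add: mult_ac)
      finally show "norm ((post_w r y x / evidence y) *\<^sub>R g x) \<le> B * exp (c\<^sup>2 / 2) / evidence y"
        using evidence_pos[of y] post_w_pos[of y x] by (simp add: divide_right_mono less_imp_le)
    qed
  qed auto
  then show ?thesis
    unfolding posterior_def
    by (subst integrable_density) (auto simp: evidence_pos post_w_pos less_imp_le)
qed

lemma prob_space_posterior: "prob_space (posterior y)"
proof (rule prob_spaceI)
  have "emeasure (posterior y) (space (posterior y)) = (\<integral>\<^sup>+x. ennreal (post_w r y x / evidence y) \<partial>M)"
    by (simp add: posterior_def emeasure_density sets_eq_imp_space_eq[OF sets_M]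
        cong: nn_integral_cong)
  also have "\<dots> = ennreal (\<integral>x. post_w r y x / evidence y \<partial>M)"
    by (rule nn_integral_eq_integral)
       (auto simp: integrable_post_w evidence_pos post_w_pos less_imp_le)
  also have "(\<integral>x. post_w r y x / evidence y \<partial>M) = 1"
    using evidence_pos[of y] by (simp add: evidence_def)
  finally show "emeasure (posterior y) (space (posterior y)) = 1" by simp
qed

sublocale posterior: prob_space "posterior y" for y
  by (rule prob_space_posterior)

lemma integrable_posterior_exp: "integrable (posterior y) (\<lambda>x. exp (c * norm (noise y x)))"
  by (rule integrable_posterior[of _ 1 c]) auto

lemma integrable_posterior_noise: "integrable (posterior y) (noise y)"
proof (rule integrable_posterior[of _ 1 1])
  show "norm (noise y x) \<le> 1 * exp (1 * norm (noise y x))" for x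
    using norm_noise_le_exp by simp
qed auto

text \<open>The mean is expressed through the noise because the weight controls the noise, unlike r
  * x alone, uniformly in \<open>y\<close>.\<close>

lemma post_mean_eq: "pmean y = y - (\<integral>x. noise y x \<partial>posterior y)"
proof -
  have "pmean y = (\<integral>x. r *\<^sub>R x \<partial>posterior y)"
    by (subst integral_posterior) (simp_all only: post_mean_def evidence_def borel_measurable_scaleR
        borel_measurable_const measurable_ident_sets)
  also have "\<dots> = (\<integral>x. y - noise y x \<partial>posterior y)"
    by (simp add: noise_def)
  also have "\<dots> = y - (\<integral>x. noise y x \<partial>posterior y)"
    by (subst Bochner_Integration.integral_diff)
       (use posterior.prob_space[of y] in \<open>auto simp: integrable_posterior_noise\<close>)
  finally show ?thesis .
qed

section \<open>Second moments about the posterior mean\<close>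

definition dev :: "'a \<Rightarrow> 'a \<Rightarrow> 'a" where
  "dev y x = r *\<^sub>R x - pmean y"

lemma dev_eq: "dev y x = (y - pmean y) - noise y x"
  by (simp add: dev_def noise_def)

lemma dev_measurable [measurable]: "dev y \<in> borel_measurable borel"
  unfolding dev_def by measurable

lemma norm_dev_le: "norm (dev y x) \<le> (1 + norm (y - pmean y)) * exp (norm (noise y x))"
proof -
  have "norm (dev y x) \<le> norm (y - pmean y) * 1 + norm (noise y x)"
    unfolding dev_eq using norm_triangle_ineq4 by simp
  also have "\<dots> \<le> norm (y - pmean y) * exp (norm (noise y x)) + exp (norm (noise y x))"
    by (intro add_mono mult_left_mono norm_noise_le_exp) auto
  finally show ?thesis by (simp add: algebra_simps)
qed

lemma norm_dev_sq_le: "(norm (dev y x))\<^sup>2 \<le> (1 + norm (y - pmean y))\<^sup>2 * exp (2 * norm (noise y x))"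
  using power_mono[OF norm_dev_le norm_ge_zero, of y x 2]
  by (simp add: power_mult_distrib exp_double)

lemma integrable_posterior_exp_dev_sq:
  "integrable (posterior y) (\<lambda>x. exp (c * norm (noise y x)) * (norm (dev y x))\<^sup>2)"
proof (rule integrable_posterior[of _ "(1 + norm (y - pmean y))\<^sup>2" "c + 2"])
  fix x
  have "exp (c * norm (noise y x)) * (norm (dev y x))\<^sup>2
      \<le> exp (c * norm (noise y x)) * ((1 + norm (y - pmean y))\<^sup>2 * exp (2 * norm (noise y x)))"
    by (intro mult_left_mono norm_dev_sq_le) simp
  then show "norm (exp (c * norm (noise y x)) * (norm (dev y x))\<^sup>2)
      \<le> (1 + norm (y - pmean y))\<^sup>2 * exp ((c + 2) * norm (noise y x))"
    by (simp add: distrib_right exp_add mult_ac)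
qed auto

lemma integrable_posterior_dev_sq: "integrable (posterior y) (\<lambda>x. (norm (dev y x))\<^sup>2)"
  using integrable_posterior_exp_dev_sq[of y 0] by simp

lemma integrable_posterior_dev: "integrable (posterior y) (dev y)"
  by (rule integrable_posterior[of _ _ 1]) (use norm_dev_le in auto)

lemma integrable_posterior_inner_dev:
  "integrable (posterior y) (\<lambda>x. (dev y x \<bullet> u) *\<^sub>R dev y x)"
proof (rule Bochner_Integration.integrable_bound)
  show "integrable (posterior y) (\<lambda>x. (norm (dev y x))\<^sup>2 * norm u)"
    by (rule integrable_mult_left) (rule integrable_posterior_dev_sq)
  have "\<bar>dev y x \<bullet> u\<bar> * norm (dev y x) \<le> (norm (dev y x) * norm u) * norm (dev y x)" for x
    by (rule mult_right_mono) (auto simp: Cauchy_Schwarz_ineq2)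
  then show "AE x in posterior y. norm ((dev y x \<bullet> u) *\<^sub>R dev y x) \<le> norm ((norm (dev y x))\<^sup>2 * norm u)"
    by (intro AE_I2) (simp add: power2_eq_square mult_ac)
qed auto

lemma integral_posterior_dev: "(\<integral>x. dev y x \<partial>posterior y) = 0"
  unfolding dev_eq
  by (subst Bochner_Integration.integral_diff)
     (use posterior.prob_space[of y] in \<open>auto simp: integrable_posterior_noise post_mean_eq\<close>)

lemma post_cov_eq: "post_cov r M y v = (\<integral>x. (dev y x \<bullet> v) *\<^sub>R dev y x \<partial>posterior y)"
  by (subst integral_posterior) (simp_all add: post_cov_def dev_def[symmetric] evidence_def)

lemma inner_post_cov: "u \<bullet> post_cov r M y v = (\<integral>x. (dev y x \<bullet> u) * (dev y x \<bullet> v) \<partial>posterior y)"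
  unfolding post_cov_eq
  by (subst integral_inner_right[symmetric], rule integrable_posterior_inner_dev)
     (auto intro!: Bochner_Integration.integral_cong simp: inner_commute[of u])

lemma linear_post_cov: "linear (post_cov r M y)"
proof (rule linearI)
  show "post_cov r M y (u + v) = post_cov r M y u + post_cov r M y v" for u v
    by (simp add: post_cov_eq inner_add_right scaleR_add_left integrable_posterior_inner_dev)
  show "post_cov r M y (c *\<^sub>R v) = c *\<^sub>R post_cov r M y v" for c v
    by (simp add: post_cov_eq flip: scaleR_scaleR)
qed

lemma integrable_posterior_inner_sq: "integrable (posterior y) (\<lambda>x. (dev y x \<bullet> u)\<^sup>2)"
proof -
  have "integrable (posterior y) (\<lambda>x. u \<bullet> ((dev y x \<bullet> u) *\<^sub>R dev y x))"
    by (rule integrable_inner_right) (rule integrable_posterior_inner_dev)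
  then show ?thesis by (simp add: inner_commute power2_eq_square)
qed

lemma inner_post_cov_self: "u \<bullet> post_cov r M y u = (\<integral>x. (dev y x \<bullet> u)\<^sup>2 \<partial>posterior y)"
  by (simp add: inner_post_cov power2_eq_square)

lemma inner_post_cov_le_Lfun: "(\<integral>x. (dev y x \<bullet> u)\<^sup>2 \<partial>posterior y) \<le> Lfun r M y * (norm u)\<^sup>2"
proof -
  have "u \<bullet> post_cov r M y u \<le> norm u * norm (post_cov r M y u)" by (rule norm_cauchy_schwarz)
  also have "\<dots> \<le> norm u * (onorm (post_cov r M y) * norm u)"
    by (intro mult_left_mono onorm) (simp_all add: linear_conv_bounded_linear[symmetric] linear_post_cov)
  finally show ?thesis
    by (simp add: inner_post_cov_self Lfun_def power2_eq_square mult_ac)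
qed

lemma Lfun_nonneg: "0 \<le> Lfun r M y"
  unfolding Lfun_def by (rule onorm_pos_le) (simp add: linear_conv_bounded_linear[symmetric] linear_post_cov)

text \<open>Nonnegativity of the variance along u - v is the polar inequality required by
  \<open>onorm_le_quadratic_form\<close>. With \<open>inner_post_cov_le_Lfun\<close> this identifies
  \<open>Lfun\<close> as the largest posterior variance along a unit vector, which is the form used
  from here on.\<close>

lemma Lfun_le:
  assumes "0 \<le> B" and "\<And>u. (\<integral>x. (dev y x \<bullet> u)\<^sup>2 \<partial>posterior y) \<le> B * (norm u)\<^sup>2"
  shows "Lfun r M y \<le> B"
  unfolding Lfun_def
proof (rule onorm_le_quadratic_form[OF linear_post_cov \<open>0 \<le> B\<close>])
  show "u \<bullet> post_cov r M y u \<le> B * (norm u)\<^sup>2" for u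
    using assms(2) by (simp add: inner_post_cov_self)
  show "u \<bullet> post_cov r M y v \<le> (u \<bullet> post_cov r M y u + v \<bullet> post_cov r M y v) / 2" for u v
  proof -
    have "0 \<le> (\<integral>x. (dev y x \<bullet> (u - v))\<^sup>2 \<partial>posterior y)" by simp
    also have "\<dots> = u \<bullet> post_cov r M y u + v \<bullet> post_cov r M y v - 2 * (u \<bullet> post_cov r M y v)"
    proof -
      have "v \<bullet> post_cov r M y u = u \<bullet> post_cov r M y v"
        by (simp add: inner_post_cov mult.commute)
      then show ?thesis
        unfolding inner_post_cov_self[symmetric]
        by (simp add: linear_diff[OF linear_post_cov] inner_diff_left inner_diff_right)
    qed
    finally show ?thesis by simp
  qed
qed

section \<open>Derivatives of the evidence and of the posterior mean\<close>

lemma has_derivative_post_w: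
  "((\<lambda>y. post_w r y x) has_derivative (\<lambda>h. - (post_w r y x * (noise y x \<bullet> h)))) (at y)"
  unfolding post_w_def noise_def power2_norm_eq_inner
  by (auto intro!: derivative_eq_intros simp: inner_commute)

lemma has_derivative_evidence:
  "(evidence has_derivative (\<lambda>h. \<integral>x. - (post_w r y x * (noise y x \<bullet> h)) \<partial>M)) (at y)"
  unfolding evidence_def [abs_def]
proof (rule has_derivative_integral_dominated[where C = 1])
  show "((\<lambda>y. post_w r y x) has_derivative (\<lambda>h. - (post_w r y x * (noise y x \<bullet> h)))) (at y)" for x y
    by (rule has_derivative_post_w)
  show "norm (- (post_w r y x * (noise y x \<bullet> h))) \<le> 1 * norm h" for x y h
  proof -
    have "\<bar>post_w r y x * (noise y x \<bullet> h)\<bar> \<le> post_w r y x * (norm (noise y x) * norm h)"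
      by (simp add: abs_mult post_w_pos less_imp_le mult_left_mono Cauchy_Schwarz_ineq2)
    also have "\<dots> \<le> 1 * norm h"
      unfolding mult.assoc[symmetric] by (intro mult_right_mono post_w_norm_noise_le) simp
    finally show ?thesis by simp
  qed
qed (auto simp: finite_measure_axioms integrable_post_w)

lemma has_derivative_weighted_noise:
  "((\<lambda>y. \<integral>x. post_w r y x *\<^sub>R noise y x \<partial>M) has_derivative
     (\<lambda>h. \<integral>x. post_w r y x *\<^sub>R (h - (noise y x \<bullet> h) *\<^sub>R noise y x) \<partial>M)) (at y)"
proof (rule has_derivative_integral_dominated[where C = 3])
  show "((\<lambda>y. post_w r y x *\<^sub>R noise y x) has_derivative
      (\<lambda>h. post_w r y x *\<^sub>R (h - (noise y x \<bullet> h) *\<^sub>R noise y x))) (at y)" for x y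
  proof -
    have "((\<lambda>y. noise y x) has_derivative (\<lambda>h. h)) (at y)"
      unfolding noise_def by (auto intro!: derivative_eq_intros)
    from has_derivative_scaleR[OF has_derivative_post_w this]
    show ?thesis by (rule has_derivative_eq_rhs) (simp add: fun_eq_iff scaleR_diff_right)
  qed
  show "norm (post_w r y x *\<^sub>R (h - (noise y x \<bullet> h) *\<^sub>R noise y x)) \<le> 3 * norm h" for x y h
  proof -
    have "norm (h - (noise y x \<bullet> h) *\<^sub>R noise y x) \<le> norm h + norm (noise y x) * norm h * norm (noise y x)"
      by (rule order_trans[OF norm_triangle_ineq4])
         (auto intro!: mult_right_mono Cauchy_Schwarz_ineq2)
    then have "post_w r y x * norm (h - (noise y x \<bullet> h) *\<^sub>R noise y x)
        \<le> post_w r y x * (norm h + norm (noise y x) * norm h * norm (noise y x))"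
      by (rule mult_left_mono) (simp add: post_w_pos less_imp_le)
    also have "\<dots> = (post_w r y x + post_w r y x * (norm (noise y x))\<^sup>2) * norm h"
      by (simp add: algebra_simps power2_eq_square)
    also have "\<dots> \<le> (1 + 2) * norm h"
      by (intro mult_right_mono add_mono post_w_le_1 post_w_norm_noise_sq_le) simp
    finally show ?thesis by (simp add: post_w_pos less_imp_le)
  qed
  show "integrable M (\<lambda>x. post_w r y x *\<^sub>R noise y x)" for y
    by (rule integrable_const_bound[of _ 1]) (auto simp: post_w_pos less_imp_le post_w_norm_noise_le)
qed (auto simp: finite_measure_axioms)

lemma has_derivative_post_mean: "(post_mean r M has_derivative post_cov r M y) (at y)"
proof -
  let ?E = "\<lambda>g. \<integral>x. g x \<partial>posterior y"
  have ev_nz: "evidence y \<noteq> 0" using evidence_pos[of y] by simp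
  have E_noise: "(\<integral>x. post_w r y x *\<^sub>R noise y x \<partial>M) = evidence y *\<^sub>R (y - pmean y)" for y
    using evidence_pos[of y] by (simp add: post_mean_eq integral_posterior)
  have pm: "post_mean r M = (\<lambda>y. y - inverse (evidence y) *\<^sub>R (\<integral>x. post_w r y x *\<^sub>R noise y x \<partial>M))"
    using evidence_pos by (auto simp: fun_eq_iff post_mean_eq integral_posterior)
  have "((\<lambda>y. y - inverse (evidence y) *\<^sub>R (\<integral>x. post_w r y x *\<^sub>R noise y x \<partial>M)) has_derivative
     (\<lambda>h. h - (inverse (evidence y) *\<^sub>R (\<integral>x. post_w r y x *\<^sub>R (h - (noise y x \<bullet> h) *\<^sub>R noise y x) \<partial>M)
       + (- (inverse (evidence y) * (\<integral>x. - (post_w r y x * (noise y x \<bullet> h)) \<partial>M) * inverse (evidence y)))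
          *\<^sub>R (\<integral>x. post_w r y x *\<^sub>R noise y x \<partial>M)))) (at y)"
    by (intro has_derivative_diff[OF has_derivative_ident]
        has_derivative_scaleR[OF Deriv.has_derivative_inverse[OF ev_nz has_derivative_evidence]
          has_derivative_weighted_noise])
  moreover have "h - (inverse (evidence y) *\<^sub>R (\<integral>x. post_w r y x *\<^sub>R (h - (noise y x \<bullet> h) *\<^sub>R noise y x) \<partial>M)
       + (- (inverse (evidence y) * (\<integral>x. - (post_w r y x * (noise y x \<bullet> h)) \<partial>M) * inverse (evidence y)))
          *\<^sub>R (\<integral>x. post_w r y x *\<^sub>R noise y x \<partial>M)) = post_cov r M y h" for h
  proof -
    \<comment> \<open>Centring the noise at its posterior mean \<open>m\<close> makes the mixed
      terms integrate to zero; what remains besides the covariance, (m . h) m, cancels against the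
      derivative of the normalising constant.\<close>
    define m where "m = y - pmean y"
    have nz: "noise y x = m - dev y x" for x by (simp add: m_def dev_eq)
    have 1: "inverse (evidence y) *\<^sub>R (\<integral>x. post_w r y x *\<^sub>R (h - (noise y x \<bullet> h) *\<^sub>R noise y x) \<partial>M)
        = ?E (\<lambda>x. h - (noise y x \<bullet> h) *\<^sub>R noise y x)"
      by (simp add: integral_posterior)
    have 2: "inverse (evidence y) * (\<integral>x. - (post_w r y x * (noise y x \<bullet> h)) \<partial>M) = - ?E (\<lambda>x. noise y x \<bullet> h)"
      by (simp add: integral_posterior)
    have 3: "?E (\<lambda>x. noise y x \<bullet> h) = m \<bullet> h"
      by (subst integral_inner_left) (simp_all add: integrable_posterior_noise m_def post_mean_eq)
    have "(\<lambda>x. h - (noise y x \<bullet> h) *\<^sub>R noise y x)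
      = (\<lambda>x. (h - (m \<bullet> h) *\<^sub>R m) + (m \<bullet> h) *\<^sub>R dev y x + (dev y x \<bullet> h) *\<^sub>R m - (dev y x \<bullet> h) *\<^sub>R dev y x)"
      by (simp add: nz fun_eq_iff algebra_simps inner_diff_left)
    then have 4: "?E (\<lambda>x. h - (noise y x \<bullet> h) *\<^sub>R noise y x)
        = (h - (m \<bullet> h) *\<^sub>R m) - post_cov r M y h"
      using posterior.prob_space[of y]
      by (simp add: integrable_posterior_dev integrable_posterior_inner_dev integral_posterior_dev
          post_cov_eq)
    show ?thesis
      unfolding 1 2 3 4 using evidence_pos[of y] by (simp add: E_noise m_def)
  qed
  ultimately show ?thesis by (simp add: pm fun_eq_iff)
qed

section \<open>An integrable envelope of the posterior covariance\<close>

text \<open>The conditional expectation of exp (c * |Z|) given Y_r = y.\<close>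

definition noise_mgf :: "real \<Rightarrow> 'a \<Rightarrow> real" where
  "noise_mgf c y = (\<integral>x. exp (c * norm (noise y x)) \<partial>posterior y)"

text \<open>The prefactor divided by \<open>noise_mgf (- \<epsilon>) y\<close> bounds evidence y /
  evidence (y + w) for |w| \<le> \<epsilon>. The bracket bounds the second moment of
  \<open>dev y\<close> along a unit vector once the posterior weight is enlarged by exp (\<epsilon>
  * |noise|). At \<epsilon> = 0 the formula is \<open>Lfun\<close> itself.\<close>

definition cov_env :: "real \<Rightarrow> 'a \<Rightarrow> real" where
  "cov_env \<epsilon> y = exp (\<epsilon>\<^sup>2 / 2)
     * (Lfun r M y + (\<integral>x. (exp (\<epsilon> * norm (noise y x)) - 1) * (norm (dev y x))\<^sup>2 \<partial>posterior y))
     / noise_mgf (- \<epsilon>) y"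

lemma noise_mgf_pos: "0 < noise_mgf c y"
proof -
  have "noise_mgf c y \<noteq> 0"
  proof
    assume "noise_mgf c y = 0"
    then have "AE x in posterior y. exp (c * norm (noise y x)) = 0"
      using integral_nonneg_eq_0_iff_AE[OF integrable_posterior_exp[of y c]]
      by (simp add: noise_mgf_def)
    then show False by simp
  qed
  moreover have "0 \<le> noise_mgf c y"
    unfolding noise_mgf_def by (rule Bochner_Integration.integral_nonneg) simp
  ultimately show ?thesis by simp
qed

lemma noise_mgf_mono: "c \<le> d \<Longrightarrow> noise_mgf c y \<le> noise_mgf d y"
  unfolding noise_mgf_def
  by (rule integral_mono) (auto simp: integrable_posterior_exp mult_right_mono)

lemma noise_mgf_0 [simp]: "noise_mgf 0 y = 1"
  using posterior.prob_space[of y] by (simp add: noise_mgf_def)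

lemma noise_mgf_ge_1: "0 \<le> c \<Longrightarrow> 1 \<le> noise_mgf c y"
  using noise_mgf_mono[of 0 c y] by simp

text \<open>A variance is nonnegative. This merges products of moments into one moment with a larger
  exponent.\<close>

lemma noise_mgf_sq_le: "(noise_mgf c y)\<^sup>2 \<le> noise_mgf (2 * c) y"
proof -
  have sq: "(exp (c * norm (noise y x)))\<^sup>2 = exp (2 * c * norm (noise y x))" for x
    by (simp add: exp_double[symmetric] mult_ac)
  have "0 \<le> posterior.variance y (\<lambda>x. exp (c * norm (noise y x)))"
    by (rule posterior.variance_positive)
  also have "\<dots> = noise_mgf (2 * c) y - (noise_mgf c y)\<^sup>2"
    by (subst posterior.variance_eq) (simp_all add: integrable_posterior_exp sq noise_mgf_def)
  finally show ?thesis by simp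
qed

text \<open>Jensen for the convex function 1/z at z = exp (- c * |noise|), whose mean is
  \<open>m\<close>: the tangent 2/m - z/m^2 at \<open>m\<close> has mean 1/m and lies below 1/z by
  an explicit square.\<close>

lemma inverse_noise_mgf_minus_le: "1 / noise_mgf (- c) y \<le> noise_mgf c y"
proof -
  define m where "m = noise_mgf (- c) y"
  have "0 < m" unfolding m_def by (rule noise_mgf_pos)
  have "1 / m = (\<integral>x. 2 / m - exp (- c * norm (noise y x)) / m\<^sup>2 \<partial>posterior y)"
    using \<open>0 < m\<close> integrable_posterior_exp[of y "- c"] posterior.prob_space[of y]
    by (simp add: noise_mgf_def[symmetric] m_def[symmetric] power2_eq_square)
       (simp add: noise_mgf_def m_def field_simps)
  also have "\<dots> \<le> noise_mgf c y"
    unfolding noise_mgf_def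
  proof (rule integral_mono)
    fix x
    let ?e = "exp (c * norm (noise y x))"
    have "0 \<le> (?e * m - 1)\<^sup>2 / (?e * m\<^sup>2)" by simp
    also have "\<dots> = ?e - 2 / m + inverse ?e / m\<^sup>2"
      using \<open>0 < m\<close> by (simp add: power2_eq_square field_simps)
    finally show "2 / m - exp (- c * norm (noise y x)) / m\<^sup>2 \<le> ?e"
      by (simp add: exp_minus)
  qed (use integrable_posterior_exp[of y "- c"] integrable_posterior_exp[of y c] in auto)
  finally show ?thesis by (simp add: m_def)
qed

lemma integrable_M_weighted:
  fixes g :: "'a \<Rightarrow> real"
  assumes [measurable]: "g \<in> borel_measurable borel" and "integrable (posterior y) g"
  shows "integrable M (\<lambda>x. post_w r y x * g x)"
proof -
  have "integrable M (\<lambda>x. (post_w r y x / evidence y) *\<^sub>R g x)"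
    using assms(2) unfolding posterior_def
    by (subst (asm) integrable_density) (auto simp: evidence_pos less_imp_le)
  then have "integrable M (\<lambda>x. evidence y * ((post_w r y x / evidence y) *\<^sub>R g x))"
    by (rule integrable_mult_right)
  then show ?thesis using evidence_pos[of y] by simp
qed

lemma integral_M_weighted:
  fixes g :: "'a \<Rightarrow> real"
  assumes [measurable]: "g \<in> borel_measurable borel"
  shows "(\<integral>x. post_w r y x * g x \<partial>M) = evidence y * (\<integral>x. g x \<partial>posterior y)"
  using evidence_pos[of y] by (simp add: integral_posterior)

section \<open>Comparison of the posteriors at \<open>y\<close> and at \<open>y + w\<close>\<close>

lemma noise_shift: "noise (y + w) x = noise y x + w"
  by (simp add: noise_def)

text \<open>In |n + w|^2 = |n|^2 + 2 n . w + |w|^2 the last term may be discarded for an upper bound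
  on the weight; in the lower bound that follows it costs exp (- \<epsilon>^2 / 2), the origin of
  the prefactor in \<open>cov_env\<close>.\<close>

lemma post_w_shift_le:
  assumes "norm w \<le> \<epsilon>"
  shows "post_w r (y + w) x \<le> post_w r y x * exp (\<epsilon> * norm (noise y x))"
proof -
  have "- (noise y x \<bullet> w) \<le> norm (noise y x) * norm w"
    using Cauchy_Schwarz_ineq2[of "noise y x" w] by linarith
  also have "\<dots> \<le> norm (noise y x) * \<epsilon>" using assms by (intro mult_left_mono) auto
  finally have "(norm (noise y x))\<^sup>2 \<le> (norm (noise y x + w))\<^sup>2 + 2 * (norm (noise y x) * \<epsilon>)"
    using norm_add_sq[of "noise y x" w] zero_le_power2[of "norm w"] by linarith
  then have "- (norm (noise y x + w))\<^sup>2 / 2 \<le> - (norm (noise y x))\<^sup>2 / 2 + \<epsilon> * norm (noise y x)"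
    by (simp add: field_simps)
  then show ?thesis by (simp add: post_w_noise noise_shift exp_add[symmetric])
qed

lemma post_w_shift_ge:
  assumes "norm w \<le> \<epsilon>"
  shows "exp (- \<epsilon>\<^sup>2 / 2) * (post_w r y x * exp (- \<epsilon> * norm (noise y x))) \<le> post_w r (y + w) x"
proof -
  have "noise y x \<bullet> w \<le> norm (noise y x) * norm w"
    by (rule norm_cauchy_schwarz)
  also have "\<dots> \<le> norm (noise y x) * \<epsilon>" using assms by (intro mult_left_mono) auto
  finally have "2 * (noise y x \<bullet> w) \<le> 2 * (norm (noise y x) * \<epsilon>)" by simp
  moreover have "(norm w)\<^sup>2 \<le> \<epsilon>\<^sup>2" using assms by (intro power_mono) auto
  ultimately have "(norm (noise y x))\<^sup>2 + 2 * (noise y x \<bullet> w) + (norm w)\<^sup>2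
      \<le> (norm (noise y x))\<^sup>2 + 2 * (norm (noise y x) * \<epsilon>) + \<epsilon>\<^sup>2" by linarith
  then have "- \<epsilon>\<^sup>2 / 2 + (- (norm (noise y x))\<^sup>2 / 2 - \<epsilon> * norm (noise y x)) \<le> - (norm (noise y x + w))\<^sup>2 / 2"
    by (simp add: power2_norm_eq_inner inner_add_left inner_add_right inner_commute field_simps)
  then show ?thesis by (simp add: post_w_noise noise_shift exp_add[symmetric])
qed

lemma evidence_shift_ge:
  assumes "norm w \<le> \<epsilon>"
  shows "exp (- \<epsilon>\<^sup>2 / 2) * (evidence y * noise_mgf (- \<epsilon>) y) \<le> evidence (y + w)"
proof -
  have "exp (- \<epsilon>\<^sup>2 / 2) * (evidence y * noise_mgf (- \<epsilon>) y)
      = (\<integral>x. exp (- \<epsilon>\<^sup>2 / 2) * (post_w r y x * exp (- \<epsilon> * norm (noise y x))) \<partial>M)"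
    by (simp add: integral_M_weighted noise_mgf_def)
  also have "\<dots> \<le> evidence (y + w)"
    unfolding evidence_def
    by (intro integral_mono integrable_mult_right integrable_M_weighted integrable_posterior_exp
        integrable_post_w post_w_shift_ge[OF assms]) auto
  finally show ?thesis .
qed

lemma integrable_posterior_exp_minus_1_dev_sq:
  "integrable (posterior y) (\<lambda>x. (exp (c * norm (noise y x)) - 1) * (norm (dev y x))\<^sup>2)"
  using Bochner_Integration.integrable_diff[OF integrable_posterior_exp_dev_sq[of y c]
      integrable_posterior_dev_sq[of y]]
  by (simp add: algebra_simps)

lemma integrable_posterior_exp_inner_sq:
  "integrable (posterior y) (\<lambda>x. exp (c * norm (noise y x)) * (dev y x \<bullet> u)\<^sup>2)"
proof (rule Bochner_Integration.integrable_bound)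
  show "integrable (posterior y) (\<lambda>x. exp (c * norm (noise y x)) * (norm (dev y x))\<^sup>2 * (norm u)\<^sup>2)"
    by (intro integrable_mult_left integrable_posterior_exp_dev_sq)
  show "AE x in posterior y. norm (exp (c * norm (noise y x)) * (dev y x \<bullet> u)\<^sup>2)
      \<le> norm (exp (c * norm (noise y x)) * (norm (dev y x))\<^sup>2 * (norm u)\<^sup>2)"
    using Cauchy_Schwarz_ineq[of "dev y _" u]
    by (intro AE_I2) (simp add: mult.assoc power2_norm_eq_inner)
qed auto

text \<open>Cauchy-Schwarz is spent only on the part weighted by exp - 1, which vanishes with
  \<epsilon>. Applied to the whole integrand it would leave the trace of the covariance in the limit
  instead of its operator norm.\<close>

lemma exp_dev_inner_le:
  assumes "0 \<le> \<epsilon>"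
  shows "(\<integral>x. exp (\<epsilon> * norm (noise y x)) * (dev y x \<bullet> u)\<^sup>2 \<partial>posterior y)
    \<le> (Lfun r M y + (\<integral>x. (exp (\<epsilon> * norm (noise y x)) - 1) * (norm (dev y x))\<^sup>2 \<partial>posterior y)) * (norm u)\<^sup>2"
proof -
  have cs: "(dev y x \<bullet> u)\<^sup>2 \<le> (norm (dev y x))\<^sup>2 * (norm u)\<^sup>2" for x
    using Cauchy_Schwarz_ineq[of "dev y x" u] by (simp add: power2_norm_eq_inner)
  have "(\<integral>x. exp (\<epsilon> * norm (noise y x)) * (dev y x \<bullet> u)\<^sup>2 \<partial>posterior y)
     \<le> (\<integral>x. (dev y x \<bullet> u)\<^sup>2 + (exp (\<epsilon> * norm (noise y x)) - 1) * (norm (dev y x))\<^sup>2 * (norm u)\<^sup>2 \<partial>posterior y)"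
  proof (rule integral_mono)
    show "integrable (posterior y) (\<lambda>x. exp (\<epsilon> * norm (noise y x)) * (dev y x \<bullet> u)\<^sup>2)"
      by (rule integrable_posterior_exp_inner_sq)
    show "integrable (posterior y) (\<lambda>x. (dev y x \<bullet> u)\<^sup>2 + (exp (\<epsilon> * norm (noise y x)) - 1) * (norm (dev y x))\<^sup>2 * (norm u)\<^sup>2)"
      by (intro Bochner_Integration.integrable_add integrable_posterior_inner_sq integrable_mult_left
          integrable_posterior_exp_minus_1_dev_sq)
    fix x
    have "(exp (\<epsilon> * norm (noise y x)) - 1) * (dev y x \<bullet> u)\<^sup>2
        \<le> (exp (\<epsilon> * norm (noise y x)) - 1) * ((norm (dev y x))\<^sup>2 * (norm u)\<^sup>2)"
      using assms by (intro mult_left_mono cs) simp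
    then show "exp (\<epsilon> * norm (noise y x)) * (dev y x \<bullet> u)\<^sup>2
       \<le> (dev y x \<bullet> u)\<^sup>2 + (exp (\<epsilon> * norm (noise y x)) - 1) * (norm (dev y x))\<^sup>2 * (norm u)\<^sup>2"
      by (simp add: algebra_simps)
  qed
  also have "\<dots> = (\<integral>x. (dev y x \<bullet> u)\<^sup>2 \<partial>posterior y)
      + (\<integral>x. (exp (\<epsilon> * norm (noise y x)) - 1) * (norm (dev y x))\<^sup>2 \<partial>posterior y) * (norm u)\<^sup>2"
    by (simp add: integrable_posterior_inner_sq integrable_posterior_exp_minus_1_dev_sq)
  finally show ?thesis
    using inner_post_cov_le_Lfun[of y u] by (simp add: distrib_right)
qed

lemma cov_env_nonneg:
  assumes "0 \<le> \<epsilon>" shows "0 \<le> cov_env \<epsilon> y"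
  unfolding cov_env_def
  by (intro divide_nonneg_pos mult_nonneg_nonneg add_nonneg_nonneg Lfun_nonneg noise_mgf_pos
      Bochner_Integration.integral_nonneg) (use assms in auto)

text \<open>The posterior covariance at \<open>y + w\<close> is at most the second moment about the posterior mean
  at \<open>y\<close>, and the two posteriors are mutually comparable up to factors \<open>exp (\<plusminus> \<epsilon> * norm (noise y x))\<close>.\<close>
lemma Lfun_le_cov_env:
  assumes "norm w \<le> \<epsilon>"
  shows "Lfun r M (y + w) \<le> cov_env \<epsilon> y"
proof (rule Lfun_le)
  have "0 \<le> \<epsilon>" using order_trans[OF norm_ge_zero assms] .
  then show "0 \<le> cov_env \<epsilon> y" by (rule cov_env_nonneg)
  fix u
  let ?Q = "Lfun r M y + (\<integral>x. (exp (\<epsilon> * norm (noise y x)) - 1) * (norm (dev y x))\<^sup>2 \<partial>posterior y)"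
  define c where "c = pmean (y + w) - pmean y"
  have dev_shift: "dev y x = dev (y + w) x + c" for x
    by (simp add: dev_def c_def)
  note exp_int = integrable_posterior_exp_inner_sq[of y \<epsilon> u]
  have int_shift: "integrable (posterior (y + w)) (\<lambda>x. dev (y + w) x \<bullet> u)"
    by (rule integrable_inner_left) (rule integrable_posterior_dev)
  have sq: "(dev y x \<bullet> u)\<^sup>2 = (dev (y + w) x \<bullet> u)\<^sup>2 + 2 * (c \<bullet> u) * (dev (y + w) x \<bullet> u) + (c \<bullet> u)\<^sup>2" for x
    by (simp add: dev_shift inner_add_left power2_eq_square algebra_simps)
  have int_sq: "integrable (posterior (y + w)) (\<lambda>x. (dev y x \<bullet> u)\<^sup>2)"
    unfolding sq using int_shift integrable_posterior_inner_sq[of "y + w" u] by simp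
  have "(\<integral>x. dev (y + w) x \<bullet> u \<partial>posterior (y + w)) = 0"
    by (subst integral_inner_left) (simp_all add: integrable_posterior_dev integral_posterior_dev)
  then have "(\<integral>x. (dev y x \<bullet> u)\<^sup>2 \<partial>posterior (y + w))
      = (\<integral>x. (dev (y + w) x \<bullet> u)\<^sup>2 \<partial>posterior (y + w)) + (c \<bullet> u)\<^sup>2"
    unfolding sq using int_shift integrable_posterior_inner_sq[of "y + w" u] posterior.prob_space[of "y + w"]
    by simp
  then have "(\<integral>x. (dev (y + w) x \<bullet> u)\<^sup>2 \<partial>posterior (y + w)) \<le> (\<integral>x. (dev y x \<bullet> u)\<^sup>2 \<partial>posterior (y + w))"
    by simp
  also have "\<dots> = (\<integral>x. post_w r (y + w) x * (dev y x \<bullet> u)\<^sup>2 \<partial>M) / evidence (y + w)"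
    using evidence_pos[of "y + w"] by (simp add: integral_M_weighted)
  also have "\<dots> \<le> (\<integral>x. post_w r y x * (exp (\<epsilon> * norm (noise y x)) * (dev y x \<bullet> u)\<^sup>2) \<partial>M) / evidence (y + w)"
  proof (intro divide_right_mono integral_mono)
    show "post_w r (y + w) x * (dev y x \<bullet> u)\<^sup>2 \<le> post_w r y x * (exp (\<epsilon> * norm (noise y x)) * (dev y x \<bullet> u)\<^sup>2)" for x
      unfolding mult.assoc[symmetric] by (intro mult_right_mono post_w_shift_le[OF assms]) simp
  qed (use int_sq exp_int evidence_pos[of "y + w"] in \<open>auto intro!: integrable_M_weighted\<close>)
  also have "\<dots> = evidence y * (\<integral>x. exp (\<epsilon> * norm (noise y x)) * (dev y x \<bullet> u)\<^sup>2 \<partial>posterior y) / evidence (y + w)"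
    by (subst integral_M_weighted) auto
  also have "\<dots> \<le> evidence y * (?Q * (norm u)\<^sup>2) / (exp (- \<epsilon>\<^sup>2 / 2) * (evidence y * noise_mgf (- \<epsilon>) y))"
    using evidence_pos[of y] evidence_pos[of "y + w"] noise_mgf_pos[of "- \<epsilon>" y] \<open>0 \<le> \<epsilon>\<close>
    by (intro frac_le mult_left_mono exp_dev_inner_le evidence_shift_ge[OF assms] mult_nonneg_nonneg
        add_nonneg_nonneg Lfun_nonneg Bochner_Integration.integral_nonneg) auto
  also have "\<dots> = cov_env \<epsilon> y * (norm u)\<^sup>2"
  proof -
    have "e * (q * n) / (exp (- \<epsilon>\<^sup>2 / 2) * (e * m)) = exp (\<epsilon>\<^sup>2 / 2) * q / m * n"
      if "0 < e" "0 < m" for e q n m :: real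
      using that by (simp add: exp_minus field_simps)
    from this[OF evidence_pos noise_mgf_pos] show ?thesis by (simp only: cov_env_def)
  qed
  finally show "(\<integral>x. (dev (y + w) x \<bullet> u)\<^sup>2 \<partial>posterior (y + w)) \<le> cov_env \<epsilon> y * (norm u)\<^sup>2" .
qed

lemma cov_env_mono:
  assumes "0 \<le> \<epsilon>" "\<epsilon> \<le> \<epsilon>'"
  shows "cov_env \<epsilon> y \<le> cov_env \<epsilon>' y"
  unfolding cov_env_def
proof (intro frac_le mult_mono add_mono integral_mono noise_mgf_mono noise_mgf_pos
    mult_nonneg_nonneg add_nonneg_nonneg Lfun_nonneg Bochner_Integration.integral_nonneg
    integrable_posterior_exp_minus_1_dev_sq)
  show "exp (\<epsilon>\<^sup>2 / 2) \<le> exp (\<epsilon>'\<^sup>2 / 2)" using assms by (simp add: power_mono)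
qed (use assms in \<open>auto simp: mult_right_mono\<close>)

lemma Lfun_le_cov_env_same: "0 \<le> \<epsilon> \<Longrightarrow> Lfun r M y \<le> cov_env \<epsilon> y"
  using Lfun_le_cov_env[of 0 \<epsilon> y] by simp

text \<open>Dominated convergence with the integrand at \<epsilon> = 1 as majorant: the correction
  term tends to 0 and the denominator to 1.\<close>

lemma cov_env_tendsto: "(\<lambda>n. cov_env (inverse (real (Suc n))) y) \<longlonglongrightarrow> Lfun r M y"
proof -
  let ?e = "\<lambda>n. inverse (real (Suc n))"
  have e0: "?e \<longlonglongrightarrow> 0" by (rule LIMSEQ_inverse_real_of_nat)
  have e1: "?e n \<le> 1" for n by (simp add: inverse_eq_divide)
  have "(\<lambda>n. \<integral>x. (exp (?e n * norm (noise y x)) - 1) * (norm (dev y x))\<^sup>2 \<partial>posterior y)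
      \<longlonglongrightarrow> (\<integral>x. (exp (0 * norm (noise y x)) - 1) * (norm (dev y x))\<^sup>2 \<partial>posterior y)"
  proof (rule integral_dominated_convergence[where w = "\<lambda>x. (exp (1 * norm (noise y x)) - 1) * (norm (dev y x))\<^sup>2"])
    show "AE x in posterior y. (\<lambda>n. (exp (?e n * norm (noise y x)) - 1) * (norm (dev y x))\<^sup>2)
        \<longlonglongrightarrow> (exp (0 * norm (noise y x)) - 1) * (norm (dev y x))\<^sup>2"
      by (intro AE_I2 tendsto_intros e0)
    show "AE x in posterior y. norm ((exp (?e n * norm (noise y x)) - 1) * (norm (dev y x))\<^sup>2)
        \<le> (exp (1 * norm (noise y x)) - 1) * (norm (dev y x))\<^sup>2" for n
      using mult_right_mono[OF e1[of n], of "norm (noise y _)"] by (intro AE_I2) (simp add: mult_right_mono)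
  qed (use integrable_posterior_exp_minus_1_dev_sq[of y 1] in auto)
  moreover have "(\<lambda>n. noise_mgf (- ?e n) y) \<longlonglongrightarrow> noise_mgf (- 0) y"
    unfolding noise_mgf_def
  proof (rule integral_dominated_convergence[where w = "\<lambda>_. 1"])
    show "AE x in posterior y. (\<lambda>n. exp (- ?e n * norm (noise y x))) \<longlonglongrightarrow> exp (- 0 * norm (noise y x))"
      by (intro AE_I2 tendsto_intros e0)
  qed auto
  ultimately have "(\<lambda>n. cov_env (?e n) y) \<longlonglongrightarrow> exp (0\<^sup>2 / 2)
     * (Lfun r M y + (\<integral>x. (exp (0 * norm (noise y x)) - 1) * (norm (dev y x))\<^sup>2 \<partial>posterior y)) / noise_mgf (- 0) y"
    unfolding cov_env_def using noise_mgf_pos[of "- 0" y]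
    by (intro tendsto_divide tendsto_mult tendsto_add tendsto_exp tendsto_const tendsto_power e0) auto
  then show ?thesis by simp
qed

text \<open>The envelope is a nonlinear function of posterior expectations; the aim is a multiple of
  a single \<open>noise_mgf\<close>, which is a conditional expectation and so can be integrated
  over Y_r exactly. Every product of moments is absorbed by doubling the exponent, whence 4, 8,
  16.\<close>

lemma cov_env_1_sq_le: "(cov_env 1 y)\<^sup>2 \<le> 16 * exp 1 * noise_mgf 16 y"
proof -
  let ?m = "\<lambda>c. noise_mgf c y"
  have m1: "0 \<le> c \<Longrightarrow> 1 \<le> ?m c" for c by (rule noise_mgf_ge_1)
  \<comment> \<open>At radius 1 only integrability counts, so the operator norm is replaced by the
    trace. Writing the trace as a difference of weighted moments cancels the -1 in the bracket of
    \<open>cov_env\<close>.\<close>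
  have "Lfun r M y \<le> (\<integral>x. (norm (dev y x))\<^sup>2 \<partial>posterior y)"
  proof (rule Lfun_le)
    show "(\<integral>x. (dev y x \<bullet> u)\<^sup>2 \<partial>posterior y) \<le> (\<integral>x. (norm (dev y x))\<^sup>2 \<partial>posterior y) * (norm u)\<^sup>2" for u
    proof -
      have "(\<integral>x. (dev y x \<bullet> u)\<^sup>2 \<partial>posterior y) \<le> (\<integral>x. (norm (dev y x))\<^sup>2 * (norm u)\<^sup>2 \<partial>posterior y)"
        using Cauchy_Schwarz_ineq[of "dev y _" u]
        by (intro integral_mono integrable_mult_left integrable_posterior_inner_sq integrable_posterior_dev_sq)
           (simp add: power2_norm_eq_inner)
      then show ?thesis by simp
    qed
  qed simp
  also have "\<dots> = (\<integral>x. exp (1 * norm (noise y x)) * (norm (dev y x))\<^sup>2 \<partial>posterior y)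
      - (\<integral>x. (exp (1 * norm (noise y x)) - 1) * (norm (dev y x))\<^sup>2 \<partial>posterior y)"
    by (subst Bochner_Integration.integral_diff[symmetric])
       (simp_all only: integrable_posterior_exp_minus_1_dev_sq integrable_posterior_exp_dev_sq,
        simp add: algebra_simps)
  finally have 1: "Lfun r M y + (\<integral>x. (exp (1 * norm (noise y x)) - 1) * (norm (dev y x))\<^sup>2 \<partial>posterior y)
      \<le> (\<integral>x. exp (1 * norm (noise y x)) * (norm (dev y x))\<^sup>2 \<partial>posterior y)" by simp
  have "norm (y - pmean y) \<le> ?m 1"
  proof -
    have "norm (y - pmean y) \<le> (\<integral>x. norm (noise y x) \<partial>posterior y)"
      by (simp add: post_mean_eq integral_norm_bound)
    also have "\<dots> \<le> ?m 1"
      unfolding noise_mgf_def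
      by (rule integral_mono)
         (use integrable_posterior_noise integrable_posterior_exp[of y 1] norm_noise_le_exp in auto)
    finally show ?thesis .
  qed
  then have dev: "(norm (dev y x))\<^sup>2 \<le> 2 * exp (2 * norm (noise y x)) + 2 * (?m 1)\<^sup>2" for x
  proof -
    have "norm (dev y x) \<le> norm (y - pmean y) + norm (noise y x)"
      unfolding dev_eq by (rule norm_triangle_ineq4)
    also have "\<dots> \<le> ?m 1 + exp (norm (noise y x))"
      using \<open>norm (y - pmean y) \<le> ?m 1\<close> norm_noise_le_exp by (intro add_mono)
    finally have "(norm (dev y x))\<^sup>2 \<le> (?m 1 + exp (norm (noise y x)))\<^sup>2"
      by (intro power_mono) auto
    also have "\<dots> \<le> 2 * (exp (norm (noise y x)))\<^sup>2 + 2 * (?m 1)\<^sup>2"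
      using sum_squares_bound[of "?m 1" "exp (norm (noise y x))"]
      by (simp add: power2_sum)
    finally show ?thesis by (simp add: exp_double)
  qed
  have "(\<integral>x. exp (1 * norm (noise y x)) * (norm (dev y x))\<^sup>2 \<partial>posterior y)
      \<le> (\<integral>x. 2 * exp (3 * norm (noise y x)) + 2 * (?m 1)\<^sup>2 * exp (1 * norm (noise y x)) \<partial>posterior y)"
  proof (rule integral_mono)
    fix x
    have "exp (1 * norm (noise y x)) * (norm (dev y x))\<^sup>2
        \<le> exp (1 * norm (noise y x)) * (2 * exp (2 * norm (noise y x)) + 2 * (?m 1)\<^sup>2)"
      by (intro mult_left_mono dev) simp
    also have "\<dots> = 2 * exp (3 * norm (noise y x)) + 2 * (?m 1)\<^sup>2 * exp (1 * norm (noise y x))"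
      by (simp add: algebra_simps exp_add[symmetric])
    finally show "exp (1 * norm (noise y x)) * (norm (dev y x))\<^sup>2 \<le> \<dots>" .
  qed (intro integrable_posterior_exp_dev_sq Bochner_Integration.integrable_add integrable_mult_right
        integrable_posterior_exp)+
  also have "\<dots> = 2 * ?m 3 + 2 * (?m 1)\<^sup>2 * ?m 1"
    using integrable_posterior_exp[of y 3] integrable_posterior_exp[of y 1] by (simp add: noise_mgf_def)
  also have "\<dots> \<le> 2 * ?m 4 + 2 * ?m 4"
  proof -
    \<comment> \<open>The third power of \<open>?m 1\<close> is brought under \<open>?m 4\<close> by
      squaring twice, one factor being raised to \<open>?m 2\<close> by monotonicity.\<close>
    have "(?m 1)\<^sup>2 * ?m 1 \<le> ?m 2 * ?m 2"
      using noise_mgf_sq_le[of 1 y] noise_mgf_mono[of 1 2 y] m1[of 1] m1[of 2] by (intro mult_mono) auto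
    also have "\<dots> \<le> ?m 4" using noise_mgf_sq_le[of 2 y] by (simp add: power2_eq_square)
    finally show ?thesis using noise_mgf_mono[of 3 4 y] by simp
  qed
  finally have 2: "(\<integral>x. exp (1 * norm (noise y x)) * (norm (dev y x))\<^sup>2 \<partial>posterior y) \<le> 4 * ?m 4" by simp
  have "cov_env 1 y = exp (1 / 2)
     * (Lfun r M y + (\<integral>x. (exp (1 * norm (noise y x)) - 1) * (norm (dev y x))\<^sup>2 \<partial>posterior y)) * (1 / ?m (- 1))"
    by (simp add: cov_env_def)
  also have "\<dots> \<le> exp (1 / 2) * (4 * ?m 4) * ?m 1"
    using order_trans[OF 1 2] inverse_noise_mgf_minus_le[of 1 y] m1[of 4] noise_mgf_pos[of "- 1" y]
    by (intro mult_mono) (auto intro!: add_nonneg_nonneg Lfun_nonneg Bochner_Integration.integral_nonneg)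
  also have "\<dots> \<le> exp (1 / 2) * (4 * ?m 4) * ?m 4"
    using noise_mgf_mono[of 1 4 y] m1[of 4] by (intro mult_left_mono) auto
  also have "\<dots> = exp (1 / 2) * 4 * (?m 4)\<^sup>2" by (simp add: power2_eq_square)
  also have "\<dots> \<le> exp (1 / 2) * 4 * ?m 8"
    using noise_mgf_sq_le[of 4 y] by (intro mult_left_mono) auto
  finally have "cov_env 1 y \<le> exp (1 / 2) * 4 * ?m 8" .
  then have "(cov_env 1 y)\<^sup>2 \<le> (exp (1 / 2) * 4 * ?m 8)\<^sup>2"
    by (intro power_mono cov_env_nonneg) auto
  also have "\<dots> = 16 * exp 1 * (?m 8)\<^sup>2"
    by (simp add: power_mult_distrib exp_double[symmetric])
  also have "\<dots> \<le> 16 * exp 1 * ?m 16"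
    using noise_mgf_sq_le[of 8 y] by (intro mult_left_mono) auto
  finally show ?thesis .
qed

section \<open>Measurability, and a local Lipschitz bound for the posterior mean\<close>

lemma post_mean_continuous: "continuous_on UNIV (post_mean r M)"
  by (intro has_derivative_continuous_on[of _ _ "\<lambda>y. post_cov r M y"])
     (auto intro: has_derivative_post_mean has_derivative_at_withinI)

lemma post_mean_measurable [measurable]: "post_mean r M \<in> borel_measurable borel"
  by (rule borel_measurable_continuous_onI) (rule post_mean_continuous)

lemma evidence_measurable [measurable]: "evidence \<in> borel_measurable borel"
  unfolding evidence_def [abs_def] by measurable

lemma noise_mgf_measurable [measurable]: "noise_mgf c \<in> borel_measurable borel"
  unfolding noise_mgf_def [abs_def] by (subst integral_posterior) measurable

lemma Lfun_measurable [measurable]: "Lfun r M \<in> borel_measurable borel"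
proof (subst borel_measurable_iff_less, rule allI)
  fix a
  have "open {y. Lfun r M y < a}"
  proof (rule openI)
    fix y assume "y \<in> {y. Lfun r M y < a}"
    then have "\<forall>\<^sub>F n in sequentially. cov_env (inverse (real (Suc n))) y < a"
      by (intro order_tendstoD[OF cov_env_tendsto]) auto
    then obtain n where n: "cov_env (inverse (real (Suc n))) y < a"
      by (auto simp: eventually_sequentially)
    have "Lfun r M z < a" if "z \<in> ball y (inverse (real (Suc n)))" for z
      using Lfun_le_cov_env[of "z - y" "inverse (real (Suc n))" y] n that
      by (simp add: dist_norm norm_minus_commute)
    then show "\<exists>e>0. ball y e \<subseteq> {y. Lfun r M y < a}"
      by (intro exI[of _ "inverse (real (Suc n))"]) auto
  qed
  then show "{y \<in> space borel. Lfun r M y < a} \<in> sets borel" by simp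
qed

lemma cov_env_measurable [measurable]: "cov_env \<epsilon> \<in> borel_measurable borel"
proof -
  have "(\<lambda>y. \<integral>x. (exp (\<epsilon> * norm (noise y x)) - 1) * (norm (dev y x))\<^sup>2 \<partial>posterior y) \<in> borel_measurable borel"
    unfolding dev_def by (subst integral_posterior) measurable
  then show ?thesis unfolding cov_env_def [abs_def] by measurable
qed

lemma norm_post_mean_diff_le:
  assumes "norm w \<le> \<epsilon>"
  shows "norm (pmean (y + w) - pmean y) \<le> cov_env \<epsilon> y * norm w"
proof -
  have "norm (pmean (y + w) - pmean y) \<le> cov_env \<epsilon> y * norm (y + w - y)"
  proof (rule differentiable_bound[of "cball y \<epsilon>" _ "\<lambda>y. post_cov r M y"])
    fix z assume "z \<in> cball y \<epsilon>"
    then show "onorm (post_cov r M z) \<le> cov_env \<epsilon> y"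
      using Lfun_le_cov_env[of "z - y" \<epsilon> y] by (simp add: Lfun_def dist_norm norm_minus_commute)
  qed (use assms order_trans[OF norm_ge_zero assms]
      in \<open>auto simp: dist_norm intro: has_derivative_post_mean has_derivative_at_withinI\<close>)
  then show ?thesis by simp
qed

end

section \<open>Integration over the law of the channel output\<close>

lemma gauss_dens_measurable [measurable]: "gauss_dens s \<in> borel_measurable borel"
  unfolding gauss_dens_def by measurable

lemma gauss_dens_nonneg: "0 \<le> gauss_dens s v"
  by (simp add: gauss_dens_def)

lemma sets_std_gauss [measurable_cong, simp]: "sets std_gauss = sets borel"
  by (simp add: std_gauss_def)

text \<open>From c * n \<le> c^2 + n^2 / 4 half of the Gaussian exponent survives, that is, a
  Gaussian with s = sqrt 2; \<open>k\<close> is the ratio of the normalising constants times exp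
  (c^2).\<close>

lemma nn_integral_gauss_exp_norm_finite:
  "(\<integral>\<^sup>+z. ennreal (gauss_dens 1 z * exp (c * norm z)) \<partial>(lborel :: 'a::euclidean_space measure)) < \<infinity>"
proof -
  define k where "k = (2 * pi * 1\<^sup>2) powr (- real DIM('a) / 2) / (2 * pi * (sqrt 2)\<^sup>2) powr (- real DIM('a) / 2) * exp (c\<^sup>2)"
  have "0 \<le> k" by (simp add: k_def)
  have "gauss_dens 1 z * exp (c * norm z) \<le> k * gauss_dens (sqrt 2) z" for z :: 'a
  proof -
    have "0 \<le> (norm z / 2 - c)\<^sup>2" by simp
    then have "- (norm z)\<^sup>2 / 2 + c * norm z \<le> c\<^sup>2 + - (norm z)\<^sup>2 / 4"
      by (simp add: power2_eq_square algebra_simps)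
    then have "exp (- (norm z)\<^sup>2 / 2) * exp (c * norm z) \<le> exp (c\<^sup>2) * exp (- (norm z)\<^sup>2 / 4)"
      unfolding exp_add[symmetric] by (simp only: exp_le_cancel_iff)
    from mult_left_mono[OF this, of "(2 * pi * 1\<^sup>2) powr (- real DIM('a) / 2)"]
    show ?thesis by (simp add: gauss_dens_def k_def mult_ac)
  qed
  then have "(\<integral>\<^sup>+z. ennreal (gauss_dens 1 z * exp (c * norm z)) \<partial>(lborel :: 'a measure))
      \<le> (\<integral>\<^sup>+z. ennreal k * ennreal (gauss_dens (sqrt 2) z) \<partial>(lborel :: 'a measure))"
    using \<open>0 \<le> k\<close> by (intro nn_integral_mono) (simp add: ennreal_mult[symmetric] gauss_dens_nonneg ennreal_leI)
  also have "\<dots> = ennreal k"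
    by (subst nn_integral_cmult) (simp_all add: nn_integral_gauss)
  finally show ?thesis by (simp add: order_le_less_trans)
qed

context gaussian_channel begin

lemma space_M [simp]: "space M = UNIV"
  using sets_eq_imp_space_eq[OF sets_M] by simp

lemma sets_Ylaw [measurable_cong, simp]: "sets (Ylaw r M) = sets borel"
  by (simp add: Ylaw_def)

lemma space_Ylaw [simp]: "space (Ylaw r M) = UNIV"
  by (simp add: Ylaw_def)

lemma prob_space_Ylaw: "prob_space (Ylaw r M)"
proof -
  interpret G: prob_space "std_gauss :: 'a measure" by (rule prob_space_std_gauss)
  interpret pair_prob_space M "std_gauss :: 'a measure" ..
  show ?thesis unfolding Ylaw_def by (rule P.prob_space_distr) measurable
qed

sublocale Ylaw: prob_space "Ylaw r M" by (rule prob_space_Ylaw)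

text \<open>Translating \<open>lborel\<close> turns the integral over Z into one over the output, so
  that it can be exchanged with the integral over \<open>M\<close>.\<close>

lemma nn_integral_Ylaw:
  assumes [measurable]: "f \<in> borel_measurable borel"
  shows "(\<integral>\<^sup>+y. f y \<partial>Ylaw r M) = (\<integral>\<^sup>+x. (\<integral>\<^sup>+y. f y * ennreal (gauss_dens 1 (noise y x)) \<partial>lborel) \<partial>M)"
proof -
  interpret G: prob_space "std_gauss :: 'a measure" by (rule prob_space_std_gauss)
  have "(\<integral>\<^sup>+y. f y \<partial>Ylaw r M) = (\<integral>\<^sup>+p. f (case p of (x, z) \<Rightarrow> r *\<^sub>R x + z) \<partial>(M \<Otimes>\<^sub>M std_gauss))"
    unfolding Ylaw_def by (rule nn_integral_distr) measurable
  also have "\<dots> = (\<integral>\<^sup>+x. (\<integral>\<^sup>+z. f (r *\<^sub>R x + z) \<partial>std_gauss) \<partial>M)"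
    by (subst G.nn_integral_fst[symmetric]) simp_all
  also have "\<dots> = (\<integral>\<^sup>+x. (\<integral>\<^sup>+y. f y * ennreal (gauss_dens 1 (noise y x)) \<partial>lborel) \<partial>M)"
  proof (rule nn_integral_cong)
    fix x
    have "(\<integral>\<^sup>+y. f y * ennreal (gauss_dens 1 (noise y x)) \<partial>lborel)
        = (\<integral>\<^sup>+y. f y * ennreal (gauss_dens 1 (noise y x)) \<partial>distr lborel borel ((+) (r *\<^sub>R x)))"
      by (simp only: lborel_distr_plus)
    also have "\<dots> = (\<integral>\<^sup>+z. f (r *\<^sub>R x + z) * ennreal (gauss_dens 1 z) \<partial>lborel)"
      by (subst nn_integral_distr) (simp_all add: noise_def)
    also have "\<dots> = (\<integral>\<^sup>+z. f (r *\<^sub>R x + z) \<partial>std_gauss)"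
      unfolding std_gauss_def by (subst nn_integral_density) (simp_all add: mult.commute)
    finally show "(\<integral>\<^sup>+z. f (r *\<^sub>R x + z) \<partial>std_gauss)
        = (\<integral>\<^sup>+y. f y * ennreal (gauss_dens 1 (noise y x)) \<partial>lborel)" ..
  qed
  finally show ?thesis .
qed

lemma gauss_dens_noise:
  "gauss_dens 1 (noise y x) = (2 * pi) powr (- real DIM('a) / 2) * post_w r y x"
  by (simp add: gauss_dens_def post_w_noise)

text \<open>The tower property for exp (c * |Z|) given Y_r. Between the two Tonelli exchanges stands
  Bayes' rule: for fixed \<open>y\<close> the likelihood integrates over \<open>M\<close> to the
  evidence, which turns the posterior expectation back into an integral against
  \<open>post_w\<close>.\<close>

lemma nn_integral_noise_mgf:
  "(\<integral>\<^sup>+y. ennreal (noise_mgf c y) \<partial>Ylaw r M)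
    = (\<integral>\<^sup>+z. ennreal (gauss_dens 1 z * exp (c * norm z)) \<partial>(lborel :: 'a measure))"
proof -
  let ?k = "(2 * pi) powr (- real DIM('a) / 2)"
  let ?g = "\<lambda>y x. gauss_dens 1 (noise y x)"
  interpret LM: pair_sigma_finite "lborel :: 'a measure" M ..
  have "(\<integral>\<^sup>+y. ennreal (noise_mgf c y) \<partial>Ylaw r M)
      = (\<integral>\<^sup>+x. (\<integral>\<^sup>+y. ennreal (noise_mgf c y) * ennreal (?g y x) \<partial>lborel) \<partial>M)"
    by (rule nn_integral_Ylaw) measurable
  also have "\<dots> = (\<integral>\<^sup>+y. (\<integral>\<^sup>+x. ennreal (noise_mgf c y) * ennreal (?g y x) \<partial>M) \<partial>lborel)"
    by (rule LM.Fubini') measurable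
  also have "\<dots> = (\<integral>\<^sup>+y. (\<integral>\<^sup>+x. ennreal (?g y x * exp (c * norm (noise y x))) \<partial>M) \<partial>lborel)"
  proof (rule nn_integral_cong)
    fix y
    have "(\<integral>\<^sup>+x. ennreal (noise_mgf c y) * ennreal (?g y x) \<partial>M)
        = (\<integral>\<^sup>+x. ennreal (noise_mgf c y * ?k * post_w r y x) \<partial>M)"
      by (simp add: ennreal_mult[symmetric] gauss_dens_noise noise_mgf_pos less_imp_le mult.assoc)
    also have "\<dots> = ennreal (noise_mgf c y * ?k * evidence y)"
      by (subst nn_integral_eq_integral)
         (auto simp: integrable_post_w noise_mgf_pos less_imp_le evidence_def)
    also have "noise_mgf c y * ?k * evidence y
        = (\<integral>x. ?k * (post_w r y x * exp (c * norm (noise y x))) \<partial>M)"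
      by (simp add: integral_M_weighted noise_mgf_def)
    also have "ennreal \<dots> = (\<integral>\<^sup>+x. ennreal (?k * (post_w r y x * exp (c * norm (noise y x)))) \<partial>M)"
      by (intro nn_integral_eq_integral[symmetric] integrable_mult_right integrable_M_weighted
          integrable_posterior_exp) auto
    finally show "(\<integral>\<^sup>+x. ennreal (noise_mgf c y) * ennreal (?g y x) \<partial>M)
        = (\<integral>\<^sup>+x. ennreal (?g y x * exp (c * norm (noise y x))) \<partial>M)"
      by (simp add: gauss_dens_noise mult.assoc)
  qed
  also have "\<dots> = (\<integral>\<^sup>+x. (\<integral>\<^sup>+y. ennreal (?g y x * exp (c * norm (noise y x))) \<partial>lborel) \<partial>M)"
    by (rule LM.Fubini'[symmetric]) measurable
  also have "\<dots> = (\<integral>\<^sup>+x. (\<integral>\<^sup>+z. ennreal (gauss_dens 1 z * exp (c * norm z)) \<partial>(lborel :: 'a measure)) \<partial>M)"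
  proof (rule nn_integral_cong)
    fix x
    have "(\<integral>\<^sup>+y. ennreal (?g y x * exp (c * norm (noise y x))) \<partial>lborel)
        = (\<integral>\<^sup>+y. ennreal (?g y x * exp (c * norm (noise y x))) \<partial>distr lborel borel ((+) (r *\<^sub>R x)))"
      by (simp only: lborel_distr_plus)
    also have "\<dots> = (\<integral>\<^sup>+z. ennreal (gauss_dens 1 z * exp (c * norm z)) \<partial>(lborel :: 'a measure))"
      by (subst nn_integral_distr) (simp_all add: noise_def)
    finally show "(\<integral>\<^sup>+y. ennreal (?g y x * exp (c * norm (noise y x))) \<partial>lborel) = \<dots>" .
  qed
  also have "\<dots> = (\<integral>\<^sup>+z. ennreal (gauss_dens 1 z * exp (c * norm z)) \<partial>(lborel :: 'a measure))"
    using emeasure_space_1 by simp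
  finally show ?thesis .
qed

lemma integrable_noise_mgf: "integrable (Ylaw r M) (noise_mgf c)"
proof (rule integrableI_bounded)
  show "(\<integral>\<^sup>+y. ennreal (norm (noise_mgf c y)) \<partial>Ylaw r M) < \<infinity>"
    using nn_integral_noise_mgf[of c] nn_integral_gauss_exp_norm_finite[of c, where 'a = 'a]
    by (simp add: noise_mgf_pos less_imp_le)
qed measurable

lemma integrable_cov_env_1_sq: "integrable (Ylaw r M) (\<lambda>y. (cov_env 1 y)\<^sup>2)"
proof (rule Bochner_Integration.integrable_bound)
  show "integrable (Ylaw r M) (\<lambda>y. 16 * exp 1 * noise_mgf 16 y)"
    by (intro integrable_mult_right integrable_noise_mgf)
  show "AE y in Ylaw r M. norm ((cov_env 1 y)\<^sup>2) \<le> norm (16 * exp 1 * noise_mgf 16 y)"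
    using order_trans[OF cov_env_1_sq_le abs_ge_self] by (intro AE_I2) simp
qed measurable

lemma integrable_cov_env_1: "integrable (Ylaw r M) (cov_env 1)"
  by (rule Ylaw.square_integrable_imp_integrable[OF _ integrable_cov_env_1_sq]) measurable

lemma integrable_cov_env_excess:
  assumes "0 \<le> \<epsilon>" "\<epsilon> \<le> 1" "0 \<le> c"
  shows "integrable (Ylaw r M) (\<lambda>y. max 0 (cov_env \<epsilon> y - c))"
proof (rule Bochner_Integration.integrable_bound[OF integrable_cov_env_1])
  show "AE y in Ylaw r M. norm (max 0 (cov_env \<epsilon> y - c)) \<le> norm (cov_env 1 y)"
    using cov_env_mono[of \<epsilon> 1] cov_env_nonneg[of 1] assms by (intro AE_I2) (smt (verit) real_norm_def)
qed measurable

lemma integral_cov_env_excess_tendsto: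
  assumes "0 \<le> c"
  shows "(\<lambda>n. \<integral>y. max 0 (cov_env (inverse (real (Suc n))) y - c) \<partial>Ylaw r M)
    \<longlonglongrightarrow> (\<integral>y. max 0 (Lfun r M y - c) \<partial>Ylaw r M)"
proof (rule integral_dominated_convergence[where w = "cov_env 1"])
  show "AE y in Ylaw r M. (\<lambda>n. max 0 (cov_env (inverse (real (Suc n))) y - c)) \<longlonglongrightarrow> max 0 (Lfun r M y - c)"
    by (intro AE_I2 tendsto_max tendsto_diff tendsto_const cov_env_tendsto)
  show "AE y in Ylaw r M. norm (max 0 (cov_env (inverse (real (Suc n))) y - c)) \<le> cov_env 1 y" for n
  proof (rule AE_I2)
    fix y
    have "inverse (real (Suc n)) \<le> 1" by (simp add: inverse_eq_divide)
    then show "norm (max 0 (cov_env (inverse (real (Suc n))) y - c)) \<le> cov_env 1 y"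
      using cov_env_mono[of "inverse (real (Suc n))" 1 y] cov_env_nonneg[of 1 y] assms by simp
  qed
qed (use integrable_cov_env_1 in measurable)

text \<open>The threshold 1 - \<delta> is nonnegative, so the positive part lies below
  \<open>Lfun\<close>, hence below the integrable \<open>cov_env 1\<close>; this makes
  \<open>hfun\<close> finite.\<close>

lemma hfun_eq:
  assumes "\<delta> \<le> 1"
  shows "hfun M \<delta> r = ennreal (\<integral>y. max 0 (Lfun r M y - (1 - \<delta>)) \<partial>Ylaw r M)"
proof -
  have "hfun M \<delta> r = (\<integral>\<^sup>+u\<in>{1 - \<delta>..}. emeasure (Ylaw r M) {y \<in> space (Ylaw r M). u < Lfun r M y} \<partial>lborel)"
    unfolding hfun_def sfun_def by (simp add: Ylaw.emeasure_eq_measure)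
  also have "\<dots> = (\<integral>\<^sup>+y. ennreal (Lfun r M y - (1 - \<delta>)) \<partial>Ylaw r M)"
    by (rule nn_integral_layer_cake_ge) (auto intro: Ylaw.sigma_finite_measure_axioms)
  also have "\<dots> = (\<integral>\<^sup>+y. ennreal (max 0 (Lfun r M y - (1 - \<delta>))) \<partial>Ylaw r M)"
    by (simp add: ennreal_max_0 max.commute)
  also have "\<dots> = ennreal (\<integral>y. max 0 (Lfun r M y - (1 - \<delta>)) \<partial>Ylaw r M)"
  proof (rule nn_integral_eq_integral)
    show "integrable (Ylaw r M) (\<lambda>y. max 0 (Lfun r M y - (1 - \<delta>)))"
    proof (rule Bochner_Integration.integrable_bound[OF integrable_cov_env_1])
      show "AE y in Ylaw r M. norm (max 0 (Lfun r M y - (1 - \<delta>))) \<le> norm (cov_env 1 y)"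
        using Lfun_le_cov_env_same[of 1] Lfun_nonneg assms by (intro AE_I2) (smt (verit) real_norm_def)
    qed measurable
  qed simp
  finally show ?thesis .
qed

text \<open>Tweedie's formula for unit noise: the score at \<open>y\<close> is the posterior mean
  minus \<open>y\<close>.\<close>

lemma has_derivative_ln_evidence:
  "((\<lambda>y. ln (evidence y)) has_derivative (\<lambda>h. (pmean y - y) \<bullet> h)) (at y)"
proof -
  have "(\<integral>x. - (post_w r y x * (noise y x \<bullet> h)) \<partial>M) = evidence y * ((pmean y - y) \<bullet> h)" for h
  proof -
    have "(\<integral>x. noise y x \<bullet> h \<partial>posterior y) = (y - pmean y) \<bullet> h"
      by (subst integral_inner_left) (simp_all add: integrable_posterior_noise post_mean_eq)
    then show ?thesis
      by (simp add: integral_M_weighted inner_diff_left right_diff_distrib)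
  qed
  moreover have "((\<lambda>y. ln (evidence y)) has_derivative
      (\<lambda>h. (\<integral>x. - (post_w r y x * (noise y x \<bullet> h)) \<partial>M) * inverse (evidence y))) (at y)"
    using has_derivative_ln[OF evidence_pos has_derivative_evidence] by simp
  moreover have "evidence y * z * inverse (evidence y) = z" for z
    using evidence_pos[of y] by simp
  ultimately show ?thesis by simp
qed

end

section \<open>The backward map of the Ornstein-Uhlenbeck flow\<close>

text \<open>The joint law of \<open>f\<close> and \<open>g\<close> is an admissible plan, in general
  not an optimal one; only an upper bound is asked of the pushed measures.\<close>

lemma W2sq_distr_le:
  assumes "prob_space m" and [measurable_cong]: "sets m = sets borel"
    and [measurable]: "f \<in> borel_measurable borel" "g \<in> borel_measurable borel"
  shows "W2sq (distr m borel f) (distr m borel g) \<le> (\<integral>\<^sup>+x. ennreal ((norm (f x - g x))\<^sup>2) \<partial>m)"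
proof -
  interpret prob_space m by fact
  let ?p = "distr m (borel \<Otimes>\<^sub>M borel) (\<lambda>x. (f x, g x))"
  have "?p \<in> couplings (distr m borel f) (distr m borel g)"
    unfolding couplings_def by (auto simp: distr_distr comp_def intro!: prob_space_distr)
  then have "W2sq (distr m borel f) (distr m borel g) \<le> (\<integral>\<^sup>+z. ennreal ((norm (fst z - snd z))\<^sup>2) \<partial>?p)"
    unfolding W2sq_def by (rule INF_lower)
  also have "\<dots> = (\<integral>\<^sup>+x. ennreal ((norm (f x - g x))\<^sup>2) \<partial>m)"
    by (subst nn_integral_distr) simp_all
  finally show ?thesis .
qed

lemma grad_eqI:
  fixes g :: "'a::euclidean_space"
  assumes "(f has_derivative (\<lambda>h. g \<bullet> h)) (at y)"
  shows "grad f y = g"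
  unfolding grad_def
proof (rule some_equality)
  show "g' = g" if "(f has_derivative (\<lambda>h. g' \<bullet> h)) (at y)" for g'
    using has_derivative_unique[OF that assms] by (metis vector_eq_rdot)
qed fact

text \<open>The linear term keeps \<open>F\<close>, where sharpness decides the limit; the quadratic
  one uses the cruder \<open>F1\<close>, so that its coefficient does not depend on the radius. In
  the square of 1 - a + a * F the cross term has a favourable sign and is dropped.\<close>

lemma square_growth_le:
  fixes a \<eta> \<delta> F F1 :: real
  assumes "1 < a" "0 \<le> \<eta>" "0 \<le> F" "F \<le> F1"
  shows "(1 + \<eta> * (1 - a + a * F))\<^sup>2
    \<le> (1 + 2 * \<eta> * (1 - a * \<delta>) + \<eta>\<^sup>2 * a\<^sup>2) + (2 * \<eta> * a * max 0 (F - (1 - \<delta>)) + \<eta>\<^sup>2 * a\<^sup>2 * F1\<^sup>2)"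
proof -
  let ?q = "1 - a + a * F"
  have "?q = 1 - a * \<delta> + a * (F - (1 - \<delta>))" by (simp add: algebra_simps)
  also have "\<dots> \<le> 1 - a * \<delta> + a * max 0 (F - (1 - \<delta>))"
    using assms by (intro add_left_mono mult_left_mono) auto
  finally have "2 * \<eta> * ?q \<le> 2 * \<eta> * (1 - a * \<delta> + a * max 0 (F - (1 - \<delta>)))"
    using assms by (intro mult_left_mono) auto
  moreover have "?q\<^sup>2 \<le> a\<^sup>2 * (1 + F1\<^sup>2)"
  proof -
    have "?q\<^sup>2 = (a - 1)\<^sup>2 + (a * F)\<^sup>2 - 2 * ((a - 1) * (a * F))"
      by (simp add: power2_eq_square algebra_simps)
    also have "\<dots> \<le> (a - 1)\<^sup>2 + (a * F)\<^sup>2" using assms by simp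
    also have "\<dots> \<le> a\<^sup>2 + (a * F1)\<^sup>2"
      using assms by (intro add_mono power_mono mult_left_mono) auto
    finally show ?thesis by (simp add: power_mult_distrib algebra_simps)
  qed
  then have "\<eta>\<^sup>2 * ?q\<^sup>2 \<le> \<eta>\<^sup>2 * (a\<^sup>2 * (1 + F1\<^sup>2))"
    by (rule mult_left_mono) simp
  moreover have "(1 + \<eta> * ?q)\<^sup>2 = 1 + 2 * \<eta> * ?q + \<eta>\<^sup>2 * ?q\<^sup>2"
    by (simp add: power2_eq_square algebra_simps)
  ultimately have "(1 + \<eta> * ?q)\<^sup>2 \<le> 1 + 2 * \<eta> * (1 - a * \<delta> + a * max 0 (F - (1 - \<delta>))) + \<eta>\<^sup>2 * (a\<^sup>2 * (1 + F1\<^sup>2))"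
    by linarith
  also have "\<dots> = (1 + 2 * \<eta> * (1 - a * \<delta>) + \<eta>\<^sup>2 * a\<^sup>2) + (2 * \<eta> * a * max 0 (F - (1 - \<delta>)) + \<eta>\<^sup>2 * a\<^sup>2 * F1\<^sup>2)"
    by (simp add: algebra_simps)
  finally show ?thesis .
qed

section \<open>Rescaling the Ornstein-Uhlenbeck law to unit noise\<close>

locale ou_channel =
  fixes \<beta> t :: real and M :: "'a::euclidean_space measure"
  assumes \<beta>: "0 < \<beta>" and t: "0 < t" and prob_M: "prob_space M" and sets_M: "sets M = sets borel"

sublocale ou_channel \<subseteq> gaussian_channel M "snr \<beta> t"
  using prob_M sets_M by (simp add: gaussian_channel_def gaussian_channel_axioms_def)

context ou_channel begin

abbreviation "\<sigma> \<equiv> ou_sigma \<beta> t"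

text \<open>Equal to 1 / (\<beta> * \<sigma>^2), the weight that the score receives in the backward
  map after rescaling.\<close>

definition rate :: real where "rate = 1 / (1 - exp (- 2 * t))"

lemma one_minus_exp: "0 < 1 - exp (- 2 * t)" "1 - exp (- 2 * t) < 1"
  using t by auto

lemma rate_gt_1: "1 < rate"
  using one_minus_exp by (simp add: rate_def)

lemma sigma_pos: "0 < \<sigma>"
  using \<beta> one_minus_exp by (simp add: ou_sigma_def)

lemma sigma_sq: "\<beta> * \<sigma>\<^sup>2 = 1 / rate"
  using \<beta> one_minus_exp by (simp add: ou_sigma_def rate_def)

lemma exp_eq: "exp (- t) = \<sigma> * snr \<beta> t"
  using sigma_pos by (simp add: snr_def)

text \<open>Since exp (- t) = \<sigma> * r for the SNR r, X_t has the law of \<sigma> * Y_r.\<close>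

lemma ou_law_eq: "ou_law \<beta> M t = distr (Ylaw (snr \<beta> t) M) borel ((*\<^sub>R) \<sigma>)"
  unfolding ou_law_def Ylaw_def
  by (subst distr_distr) (simp_all add: comp_def exp_eq scaleR_add_right case_prod_unfold)

lemma sets_ou_law [measurable_cong, simp]: "sets (ou_law \<beta> M t) = sets borel"
  by (simp add: ou_law_def)

lemma prob_space_ou_law: "prob_space (ou_law \<beta> M t)"
  unfolding ou_law_eq by (rule Ylaw.prob_space_distr) measurable

lemma ou_density_eq:
  "ou_density \<beta> M t y = (2 * pi * \<sigma>\<^sup>2) powr (- real DIM('a) / 2) * evidence (y /\<^sub>R \<sigma>)"
proof -
  have "gauss_dens \<sigma> (y - exp (- t) *\<^sub>R x)
      = (2 * pi * \<sigma>\<^sup>2) powr (- real DIM('a) / 2) * post_w (snr \<beta> t) (y /\<^sub>R \<sigma>) x" for x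
  proof -
    have "y /\<^sub>R \<sigma> - snr \<beta> t *\<^sub>R x = inverse \<sigma> *\<^sub>R (y - exp (- t) *\<^sub>R x)"
      using sigma_pos by (simp add: exp_eq algebra_simps)
    then have "(norm (y /\<^sub>R \<sigma> - snr \<beta> t *\<^sub>R x))\<^sup>2 = (norm (y - exp (- t) *\<^sub>R x))\<^sup>2 / \<sigma>\<^sup>2"
      by (simp only: norm_scaleR power_mult_distrib power2_abs power_inverse divide_inverse mult.commute)
    then show ?thesis by (simp add: gauss_dens_def post_w_def)
  qed
  then show ?thesis by (simp add: ou_density_def evidence_def)
qed

lemma grad_ln_ou_density:
  "grad (\<lambda>y. ln (ou_density \<beta> M t y)) y = (pmean (y /\<^sub>R \<sigma>) - y /\<^sub>R \<sigma>) /\<^sub>R \<sigma>"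
proof (rule grad_eqI)
  let ?c = "(2 * pi * \<sigma>\<^sup>2) powr (- real DIM('a) / 2)"
  have "0 < ?c" using sigma_pos by simp
  then have ln_eq: "ln (ou_density \<beta> M t y) = ln ?c + ln (evidence (y /\<^sub>R \<sigma>))" for y
    unfolding ou_density_eq by (rule ln_mult_pos) (rule evidence_pos)
  have scale: "((\<lambda>y. y /\<^sub>R \<sigma>) has_derivative (\<lambda>h. h /\<^sub>R \<sigma>)) (at y)"
    by (auto intro!: derivative_eq_intros)
  have "((\<lambda>y. ln ?c + ln (evidence (y /\<^sub>R \<sigma>))) has_derivative
      (\<lambda>h. 0 + (pmean (y /\<^sub>R \<sigma>) - y /\<^sub>R \<sigma>) \<bullet> (h /\<^sub>R \<sigma>))) (at y)"
    by (intro has_derivative_add has_derivative_const has_derivative_compose[OF scale has_derivative_ln_evidence])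
  then show "((\<lambda>y. ln (ou_density \<beta> M t y)) has_derivative
      (\<lambda>h. ((pmean (y /\<^sub>R \<sigma>) - y /\<^sub>R \<sigma>) /\<^sub>R \<sigma>) \<bullet> h)) (at y)"
    by (simp add: ln_eq)
qed

text \<open>The score carries one factor 1 / \<sigma> from the chain rule, and the term y / \<sigma>
  inside it a second one; hence \<open>rate\<close> goes with \<open>y\<close> but rate * \<sigma>
  with the posterior mean.\<close>

lemma backward_map_eq:
  "backward_map \<beta> M t \<eta> y = (1 + \<eta> * (1 - rate)) *\<^sub>R y + (\<eta> * rate * \<sigma>) *\<^sub>R pmean (y /\<^sub>R \<sigma>)"
proof -
  have rate: "rate = 1 / (\<beta> * \<sigma>\<^sup>2)" using sigma_sq rate_gt_1 sigma_pos \<beta> by (simp add: field_simps)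
  have 1: "rate * \<sigma> = inverse \<beta> * inverse \<sigma>" and 2: "rate = inverse \<beta> * inverse \<sigma> * inverse \<sigma>"
    using sigma_pos \<beta> by (simp_all add: rate power2_eq_square field_simps)
  have "backward_map \<beta> M t \<eta> y
      = y + \<eta> *\<^sub>R (y + (inverse \<beta> * inverse \<sigma>) *\<^sub>R pmean (y /\<^sub>R \<sigma>) - (inverse \<beta> * inverse \<sigma> * inverse \<sigma>) *\<^sub>R y)"
    by (simp add: backward_map_def grad_ln_ou_density algebra_simps divide_inverse)
  also have "\<dots> = (1 + \<eta> * (1 - rate)) *\<^sub>R y + (\<eta> * rate * \<sigma>) *\<^sub>R pmean (y /\<^sub>R \<sigma>)"
    unfolding 2[symmetric] 1[symmetric] using sigma_pos by (simp add: algebra_simps)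
  finally show ?thesis .
qed

lemma backward_map_measurable [measurable]: "backward_map \<beta> M t \<eta> \<in> borel_measurable borel"
  unfolding backward_map_eq by measurable

text \<open>As \<open>rate\<close> exceeds 1, the coefficient of \<open>y\<close> is nonnegative
  only for small \<eta>. Then it is its own absolute value, and the triangle inequality preserves
  the negative contribution 1 - rate, the source of contraction.\<close>

lemma norm_backward_map_diff_le:
  assumes "0 \<le> \<eta>" "0 \<le> 1 + \<eta> * (1 - rate)" "norm v \<le> \<sigma> * \<epsilon>"
  shows "norm (backward_map \<beta> M t \<eta> y - backward_map \<beta> M t \<eta> (y + v))
    \<le> (1 + \<eta> * (1 - rate + rate * cov_env \<epsilon> (y /\<^sub>R \<sigma>))) * norm v"
proof -
  have "norm (v /\<^sub>R \<sigma>) \<le> \<epsilon>"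
    using assms(3) sigma_pos by (simp add: field_simps)
  from norm_post_mean_diff_le[OF this, of "y /\<^sub>R \<sigma>"]
  have pm: "norm (pmean ((y + v) /\<^sub>R \<sigma>) - pmean (y /\<^sub>R \<sigma>)) \<le> cov_env \<epsilon> (y /\<^sub>R \<sigma>) * (norm v / \<sigma>)"
    using sigma_pos by (simp add: scaleR_add_right divide_inverse mult.commute)
  have "norm (backward_map \<beta> M t \<eta> y - backward_map \<beta> M t \<eta> (y + v))
      = norm ((1 + \<eta> * (1 - rate)) *\<^sub>R v + (\<eta> * rate * \<sigma>) *\<^sub>R (pmean ((y + v) /\<^sub>R \<sigma>) - pmean (y /\<^sub>R \<sigma>)))"
    by (subst norm_minus_commute) (simp add: backward_map_eq algebra_simps)
  also have "\<dots> \<le> (1 + \<eta> * (1 - rate)) * norm v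
      + (\<eta> * rate * \<sigma>) * norm (pmean ((y + v) /\<^sub>R \<sigma>) - pmean (y /\<^sub>R \<sigma>))"
    by (rule order_trans[OF norm_triangle_ineq]) (use assms rate_gt_1 sigma_pos in simp)
  also have "\<dots> \<le> (1 + \<eta> * (1 - rate)) * norm v + (\<eta> * rate * \<sigma>) * (cov_env \<epsilon> (y /\<^sub>R \<sigma>) * (norm v / \<sigma>))"
    using assms rate_gt_1 sigma_pos by (intro add_left_mono mult_left_mono pm) simp
  also have "\<dots> = (1 + \<eta> * (1 - rate + rate * cov_env \<epsilon> (y /\<^sub>R \<sigma>))) * norm v"
    using sigma_pos by (simp add: algebra_simps)
  finally show ?thesis .
qed

section \<open>Growth of the transport cost under one backward step\<close>

lemma nn_integral_ou_law:
  assumes [measurable]: "f \<in> borel_measurable borel"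
  shows "(\<integral>\<^sup>+x. f (x /\<^sub>R \<sigma>) \<partial>ou_law \<beta> M t) = (\<integral>\<^sup>+y. f y \<partial>Ylaw (snr \<beta> t) M)"
  unfolding ou_law_eq using sigma_pos by (subst nn_integral_distr) simp_all

text \<open>Tends to the value of \<open>hfun\<close> as the radius shrinks along 1 / (n +
  1).\<close>

definition excess :: "real \<Rightarrow> real \<Rightarrow> real" where
  "excess \<delta> \<epsilon> = (\<integral>y. max 0 (cov_env \<epsilon> y - (1 - \<delta>)) \<partial>Ylaw (snr \<beta> t) M)"

definition env_moment :: real where
  "env_moment = (\<integral>y. (cov_env 1 y)\<^sup>2 \<partial>Ylaw (snr \<beta> t) M)"

lemma excess_nonneg: "0 \<le> excess \<delta> \<epsilon>"
  unfolding excess_def by (rule Bochner_Integration.integral_nonneg) simp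

lemma env_moment_nonneg: "0 \<le> env_moment"
  unfolding env_moment_def by (rule Bochner_Integration.integral_nonneg) simp

text \<open>Needed because \<open>ennreal\<close> collapses negative reals. A negative 1 - rate *
  \<delta> is harmless: its modulus is at most \<open>rate\<close>, so the quadratic term completes
  the square.\<close>

lemma base_growth_nonneg:
  assumes "0 \<le> \<delta>" "\<delta> \<le> 1"
  shows "0 \<le> 1 + 2 * \<eta> * (1 - rate * \<delta>) + \<eta>\<^sup>2 * rate\<^sup>2"
proof -
  have "rate * \<delta> \<le> rate * 1" "0 \<le> rate * \<delta>"
    using assms rate_gt_1 by simp_all
  then have "\<bar>1 - rate * \<delta>\<bar> \<le> \<bar>rate\<bar>" using rate_gt_1 by linarith
  then have "(1 - rate * \<delta>)\<^sup>2 \<le> rate\<^sup>2" by (simp only: abs_le_square_iff)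
  moreover have "1 + 2 * \<eta> * (1 - rate * \<delta>) + \<eta>\<^sup>2 * rate\<^sup>2
      = (1 + \<eta> * (1 - rate * \<delta>))\<^sup>2 + \<eta>\<^sup>2 * (rate\<^sup>2 - (1 - rate * \<delta>)\<^sup>2)"
    by (simp add: power2_eq_square algebra_simps)
  ultimately show ?thesis by simp
qed

lemma W2sq_backward_le:
  assumes \<nu>: "\<nu> \<in> Mclass (ou_law \<beta> M t) K" and fin: "W2sq (ou_law \<beta> M t) \<nu> = ennreal W" "0 \<le> W"
    and K: "0 \<le> K" and \<epsilon>: "0 \<le> \<epsilon>" "\<epsilon> \<le> 1" "K * W \<le> (\<sigma> * \<epsilon>)\<^sup>2"
    and \<eta>: "0 \<le> \<eta>" "0 \<le> 1 + \<eta> * (1 - rate)" and \<delta>: "0 \<le> \<delta>" "\<delta> \<le> 1"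
  shows "W2sq (push (backward_map \<beta> M t \<eta>) (ou_law \<beta> M t)) (push (backward_map \<beta> M t \<eta>) \<nu>)
    \<le> ennreal (W * (1 + \<eta> * (2 * (1 - rate * \<delta>) + 2 * rate * K * excess \<delta> \<epsilon> + \<eta> * (rate\<^sup>2 * (1 + K * env_moment)))))"
proof -
  let ?m = "ou_law \<beta> M t"
  let ?b = "backward_map \<beta> M t \<eta>"
  obtain T where T [measurable]: "T \<in> ?m \<rightarrow>\<^sub>M borel" and T_push: "distr ?m borel T = \<nu>"
    and T_opt: "(\<integral>\<^sup>+x. ennreal ((norm (T x - x))\<^sup>2) \<partial>?m) = W2sq ?m \<nu>"
    and T_sup: "AE x in ?m. ennreal ((norm (T x - x))\<^sup>2)
        \<le> ennreal K * (\<integral>\<^sup>+x. ennreal ((norm (T x - x))\<^sup>2) \<partial>?m)"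
    using \<nu> unfolding Mclass_def by auto
  have [measurable]: "T \<in> borel_measurable borel" using T by simp
  define A where "A = 1 + 2 * \<eta> * (1 - rate * \<delta>) + \<eta>\<^sup>2 * rate\<^sup>2"
  define B where "B y = 2 * \<eta> * rate * max 0 (cov_env \<epsilon> y - (1 - \<delta>)) + \<eta>\<^sup>2 * rate\<^sup>2 * (cov_env 1 y)\<^sup>2" for y
  have [measurable]: "B \<in> borel_measurable borel" unfolding B_def by measurable
  have B_nonneg: "0 \<le> B y" for y
    using \<eta> rate_gt_1 by (simp add: B_def)
  have int_B: "integrable (Ylaw (snr \<beta> t) M) B"
    unfolding B_def using integrable_cov_env_excess[of \<epsilon> "1 - \<delta>"] integrable_cov_env_1_sq \<epsilon> \<delta> by simp
  have "0 \<le> A"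
    unfolding A_def by (rule base_growth_nonneg) (fact \<delta>)+
  have b_le: "AE x in ?m. ennreal ((norm (?b x - ?b (T x)))\<^sup>2)
      \<le> ennreal A * ennreal ((norm (T x - x))\<^sup>2) + ennreal (K * W) * ennreal (B (x /\<^sub>R \<sigma>))"
    using T_sup
  proof (rule AE_mp, intro AE_I2 impI)
    fix x
    define v where "v = T x - x"
    assume "ennreal ((norm (T x - x))\<^sup>2) \<le> ennreal K * (\<integral>\<^sup>+x. ennreal ((norm (T x - x))\<^sup>2) \<partial>?m)"
    \<comment> \<open>This bound serves twice: it confines \<open>v\<close> to the ball on which the
      envelope is valid, and it later replaces the factor |v|^2 of \<open>B\<close>. The factor of
      \<open>A\<close> stays, to be integrated exactly by optimality of \<open>T\<close>.\<close>
    then have v_sq: "(norm v)\<^sup>2 \<le> K * W"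
      using K fin unfolding T_opt fin v_def by (simp add: ennreal_mult[symmetric])
    then have "(norm v)\<^sup>2 \<le> (\<sigma> * \<epsilon>)\<^sup>2" using \<epsilon>(3) by linarith
    then have v_le: "norm v \<le> \<sigma> * \<epsilon>"
      by (rule power2_le_imp_le) (use \<epsilon> sigma_pos in simp)
    let ?F = "cov_env \<epsilon> (x /\<^sub>R \<sigma>)"
    have "norm (?b x - ?b (T x)) \<le> (1 + \<eta> * (1 - rate + rate * ?F)) * norm v"
      using norm_backward_map_diff_le[OF \<eta> v_le, of x] by (simp add: v_def)
    then have "(norm (?b x - ?b (T x)))\<^sup>2 \<le> (1 + \<eta> * (1 - rate + rate * ?F))\<^sup>2 * (norm v)\<^sup>2"
      unfolding power_mult_distrib[symmetric] by (rule power_mono) simp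
    also have "\<dots> \<le> (A + B (x /\<^sub>R \<sigma>)) * (norm v)\<^sup>2"
      unfolding A_def B_def
      by (intro mult_right_mono square_growth_le rate_gt_1 \<eta> cov_env_nonneg cov_env_mono \<epsilon>) simp
    also have "\<dots> = A * (norm v)\<^sup>2 + B (x /\<^sub>R \<sigma>) * (norm v)\<^sup>2" by (simp add: algebra_simps)
    also have "\<dots> \<le> A * (norm v)\<^sup>2 + B (x /\<^sub>R \<sigma>) * (K * W)"
      by (intro add_left_mono mult_left_mono v_sq B_nonneg)
    finally show "ennreal ((norm (?b x - ?b (T x)))\<^sup>2)
      \<le> ennreal A * ennreal ((norm (T x - x))\<^sup>2) + ennreal (K * W) * ennreal (B (x /\<^sub>R \<sigma>))"
      using \<open>0 \<le> A\<close> B_nonneg K fin(2)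
      by (simp add: v_def ennreal_mult[symmetric] ennreal_plus[symmetric] mult.commute ennreal_leI del: ennreal_plus)
  qed
  have "push ?b \<nu> = distr ?m borel (\<lambda>x. ?b (T x))"
    unfolding push_def T_push[symmetric] by (subst distr_distr) (auto simp: comp_def)
  then have "W2sq (push ?b ?m) (push ?b \<nu>) \<le> (\<integral>\<^sup>+x. ennreal ((norm (?b x - ?b (T x)))\<^sup>2) \<partial>?m)"
    using W2sq_distr_le[OF prob_space_ou_law sets_ou_law, of ?b "\<lambda>x. ?b (T x)"] by (simp add: push_def)
  also have "\<dots> \<le> (\<integral>\<^sup>+x. ennreal A * ennreal ((norm (T x - x))\<^sup>2) + ennreal (K * W) * ennreal (B (x /\<^sub>R \<sigma>)) \<partial>?m)"
    by (rule nn_integral_mono_AE) (rule b_le)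
  also have "\<dots> = ennreal A * ennreal W + ennreal (K * W) * (\<integral>\<^sup>+y. ennreal (B y) \<partial>Ylaw (snr \<beta> t) M)"
    by (simp add: nn_integral_add nn_integral_cmult T_opt fin nn_integral_ou_law[of "\<lambda>y. ennreal (B y)"])
  also have "(\<integral>\<^sup>+y. ennreal (B y) \<partial>Ylaw (snr \<beta> t) M) = ennreal (\<integral>y. B y \<partial>Ylaw (snr \<beta> t) M)"
    by (rule nn_integral_eq_integral) (use int_B B_nonneg in auto)
  also have "ennreal A * ennreal W + ennreal (K * W) * \<dots>
      = ennreal (A * W + K * W * (\<integral>y. B y \<partial>Ylaw (snr \<beta> t) M))"
    using \<open>0 \<le> A\<close> fin(2) K B_nonneg
    by (simp add: ennreal_mult[symmetric] ennreal_plus[symmetric] del: ennreal_plus)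
  also have "(\<integral>y. B y \<partial>Ylaw (snr \<beta> t) M) = 2 * \<eta> * rate * excess \<delta> \<epsilon> + \<eta>\<^sup>2 * rate\<^sup>2 * env_moment"
    unfolding B_def excess_def env_moment_def
    using integrable_cov_env_excess[of \<epsilon> "1 - \<delta>"] integrable_cov_env_1_sq \<epsilon> \<delta> by simp
  also have "A * W + K * W * (2 * \<eta> * rate * excess \<delta> \<epsilon> + \<eta>\<^sup>2 * rate\<^sup>2 * env_moment)
      = W * (1 + \<eta> * (2 * (1 - rate * \<delta>) + 2 * rate * K * excess \<delta> \<epsilon> + \<eta> * (rate\<^sup>2 * (1 + K * env_moment))))"
    by (simp add: A_def power2_eq_square algebra_simps)
  finally show ?thesis .
qed

lemma W2sq_backward_quotient_le:
  assumes \<nu>: "\<nu> \<in> Mclass (ou_law \<beta> M t) K" and W: "0 < W2sq (ou_law \<beta> M t) \<nu>"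
    and K: "0 < K" and \<epsilon>: "0 \<le> \<epsilon>" "\<epsilon> \<le> 1" "W2sq (ou_law \<beta> M t) \<nu> < ennreal ((\<sigma> * \<epsilon>)\<^sup>2 / K)"
    and \<eta>: "0 < \<eta>" "0 \<le> 1 + \<eta> * (1 - rate)" and \<delta>: "0 \<le> \<delta>" "\<delta> \<le> 1"
  shows "(enn2ereal (W2sq (push (backward_map \<beta> M t \<eta>) (ou_law \<beta> M t)) (push (backward_map \<beta> M t \<eta>) \<nu>))
      - enn2ereal (W2sq (ou_law \<beta> M t) \<nu>)) * ereal (1 / (\<eta> * enn2real (W2sq (ou_law \<beta> M t) \<nu>)))
    \<le> ereal (2 * (1 - rate * \<delta>) + 2 * rate * K * excess \<delta> \<epsilon> + \<eta> * (rate\<^sup>2 * (1 + K * env_moment)))"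
    (is "(enn2ereal ?Wb - _) * _ \<le> ereal ?c")
proof -
  define w where "w = enn2real (W2sq (ou_law \<beta> M t) \<nu>)"
  have "W2sq (ou_law \<beta> M t) \<nu> < top" using \<epsilon>(3) by (auto intro: order_less_trans)
  then have w: "W2sq (ou_law \<beta> M t) \<nu> = ennreal w" by (simp add: w_def)
  have "0 < w" using W unfolding w by (simp add: ennreal_less_zero_iff)
  then have "w < (\<sigma> * \<epsilon>)\<^sup>2 / K" using \<epsilon>(3) unfolding w by (simp add: ennreal_less_iff)
  then have "K * w \<le> (\<sigma> * \<epsilon>)\<^sup>2" using K by (simp add: field_simps)
  then have Wb: "?Wb \<le> ennreal (w * (1 + \<eta> * ?c))"
    using \<open>0 < w\<close> K \<epsilon> \<eta> \<delta> by (intro W2sq_backward_le[OF \<nu> w]) auto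
  \<comment> \<open>Both costs are finite, so the \<open>ereal\<close> difference is one of real
    numbers.\<close>
  then have "?Wb < top" by (auto intro: order_le_less_trans)
  then have b: "?Wb = ennreal (enn2real ?Wb)" by simp
  have "1 + \<eta> * ?c = (1 + 2 * \<eta> * (1 - rate * \<delta>) + \<eta>\<^sup>2 * rate\<^sup>2)
      + (2 * \<eta> * rate * K * excess \<delta> \<epsilon> + \<eta>\<^sup>2 * rate\<^sup>2 * K * env_moment)"
    by (simp add: power2_eq_square algebra_simps)
  moreover have "0 \<le> 2 * \<eta> * rate * K * excess \<delta> \<epsilon> + \<eta>\<^sup>2 * rate\<^sup>2 * K * env_moment"
    using \<eta> rate_gt_1 K excess_nonneg[of \<delta> \<epsilon>] env_moment_nonneg by simp
  ultimately have "0 \<le> w * (1 + \<eta> * ?c)"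
    using base_growth_nonneg[OF \<delta>, of \<eta>] \<open>0 < w\<close> by simp
  then have "enn2real ?Wb \<le> w * (1 + \<eta> * ?c)"
    using Wb by (subst (asm) b) (simp only: ennreal_le_iff)
  then have "enn2real ?Wb - w \<le> ?c * (\<eta> * w)" by (simp add: algebra_simps)
  then have "(enn2real ?Wb - w) * (1 / (\<eta> * w)) \<le> ?c"
    using \<open>0 < w\<close> \<eta> by (simp add: pos_divide_le_eq)
  moreover have "enn2ereal ?Wb = ereal (enn2real ?Wb)"
    by (subst b) (rule enn2ereal_ennreal, simp)
  ultimately show ?thesis
    using \<open>0 < w\<close> unfolding w by simp
qed

end

theorem mainTheorem11:
  fixes \<beta> t K \<delta> :: real and \<mu> :: "'a::euclidean_space measure"
  assumes "\<beta> > 0" and "\<mu> \<in> P2r" and "t > 0" and "K \<ge> 1" and "0 < \<delta>" and "\<delta> \<le> 1"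
  shows "Limsup (at_right 0) (\<lambda>\<eta>.
           INF \<epsilon>\<in>{0<..}. SUP \<nu>\<in>{\<nu> \<in> Mclass (ou_law \<beta> \<mu> t) K.
                 0 < W2sq (ou_law \<beta> \<mu> t) \<nu> \<and> W2sq (ou_law \<beta> \<mu> t) \<nu> < ennreal \<epsilon>}.
             (enn2ereal (W2sq (push (backward_map \<beta> \<mu> t \<eta>) (ou_law \<beta> \<mu> t))
                               (push (backward_map \<beta> \<mu> t \<eta>) \<nu>))
              - enn2ereal (W2sq (ou_law \<beta> \<mu> t) \<nu>))
             * ereal (1 / (\<eta> * enn2real (W2sq (ou_law \<beta> \<mu> t) \<nu>))))
         \<le> ereal (2 - 2 / (1 - exp (- 2 * t)) * \<delta>)
            + ereal (2 * K / (1 - exp (- 2 * t))) * enn2ereal (hfun \<mu> \<delta> (snr \<beta> t))"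
    (is "Limsup _ ?f \<le> ?rhs")
proof -
  interpret ou_channel \<beta> t \<mu>
    by (rule ou_channel.intro) (use assms in \<open>simp_all add: P2r_def\<close>)
  define H where "H = (\<integral>y. max 0 (Lfun (snr \<beta> t) \<mu> y - (1 - \<delta>)) \<partial>Ylaw (snr \<beta> t) \<mu>)"
  define A where "A = 2 * (1 - rate * \<delta>) + 2 * rate * K * H"
  define C where "C = rate\<^sup>2 * (1 + K * env_moment)"
  \<comment> \<open>For fixed \<eta> the infimum lies below the bound for every radius, hence below
    its limit. \<open>C\<close> does not depend on the radius and disappears only when \<eta> tends
    to 0.\<close>
  have f_le: "?f \<eta> \<le> ereal (A + \<eta> * C)" if \<eta>: "0 < \<eta>" "0 \<le> 1 + \<eta> * (1 - rate)" for \<eta>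
  proof (rule tendsto_lowerbound)
    let ?e = "\<lambda>n. inverse (real (Suc n))"
    have "(\<lambda>n. 2 * (1 - rate * \<delta>) + 2 * rate * K * excess \<delta> (?e n) + \<eta> * C)
        \<longlonglongrightarrow> A + \<eta> * C"
      unfolding A_def H_def excess_def
      by (intro tendsto_intros integral_cov_env_excess_tendsto) (use assms in simp)
    then show "(\<lambda>n. ereal (2 * (1 - rate * \<delta>) + 2 * rate * K * excess \<delta> (?e n) + \<eta> * C))
        \<longlonglongrightarrow> ereal (A + \<eta> * C)" by (rule tendsto_ereal)
    show "\<forall>\<^sub>F n in sequentially. ?f \<eta> \<le> ereal (2 * (1 - rate * \<delta>) + 2 * rate * K * excess \<delta> (?e n) + \<eta> * C)"
    proof (rule always_eventually, rule allI)
      fix n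
      \<comment> \<open>A cost below (ou_sigma \<beta> t * ?e n)^2 / K keeps almost all
        displacements below ou_sigma \<beta> t * ?e n, which explains the neighbourhood chosen in
        the infimum.\<close>
      have "0 < ?e n" "?e n \<le> 1" by (simp_all add: inverse_eq_divide)
      then show "?f \<eta> \<le> ereal (2 * (1 - rate * \<delta>) + 2 * rate * K * excess \<delta> (?e n) + \<eta> * C)"
        unfolding C_def using assms sigma_pos
        by (intro INF_lower2[of "(ou_sigma \<beta> t * ?e n)\<^sup>2 / K"] SUP_least W2sq_backward_quotient_le \<eta>) auto
    qed
  qed simp
  have small: "\<forall>\<^sub>F \<eta> in at_right 0. 0 < \<eta> \<and> 0 \<le> 1 + \<eta> * (1 - rate)"
  proof -
    have "0 \<le> 1 + \<eta> * (1 - rate)" if "0 < \<eta>" "\<eta> < 1 / rate" for \<eta>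
    proof -
      have "\<eta> * rate < 1" using that rate_gt_1 by (simp add: field_simps)
      then show ?thesis using that by (simp add: algebra_simps)
    qed
    then show ?thesis
      using rate_gt_1 by (auto intro!: eventually_at_rightI[of 0 "1 / rate"])
  qed
  have "Limsup (at_right 0) ?f \<le> Limsup (at_right 0) (\<lambda>\<eta>. ereal (A + \<eta> * C))"
    by (rule Limsup_mono, rule eventually_mono[OF small]) (use f_le in blast)
  also have "\<dots> = ereal A"
  proof (rule lim_imp_Limsup)
    have "((\<lambda>\<eta>. A + \<eta> * C) \<longlongrightarrow> A + 0 * C) (at_right 0)"
      by (intro tendsto_intros)
    then show "((\<lambda>\<eta>. ereal (A + \<eta> * C)) \<longlongrightarrow> ereal A) (at_right 0)" by simp
  qed simp
  also have "ereal A = ?rhs"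
  proof -
    have "0 \<le> H" unfolding H_def by (rule Bochner_Integration.integral_nonneg) simp
    have "hfun \<mu> \<delta> (snr \<beta> t) = ennreal H" unfolding H_def by (rule hfun_eq) fact
    then show ?thesis using \<open>0 \<le> H\<close> by (simp add: A_def rate_def algebra_simps)
  qed
  finally show ?thesis .
qed

end
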